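(* Let $r$ be a complex rational function of degree $n \ge 2$ and let $f(z) = r(z) - \overline{z}$. Then $f$ has at most $3(n-1)$ sense-preserving zeros, and at most $2(n-1)$ sense-reversing or singular zeros. Moreover, if $r = \frac{p}{q}$ with $p, q$ coprime polynomials and $\deg(p) > \deg(q)$, then $f$ has at most $5(n-1)-1$ zeros.
   Context: A rational function is written $r = \frac{p}{q}$ with $p, q$ coprime complex polynomials, and its degree is $\deg(r) = \max\{\deg(p), \deg(q)\}$. A zero of $f(z) = r(z) - \overline{z}$ is a point $z_0 \in \mathbb{C}$, not a pole of $r$, with $r(z_0) = \overline{z_0}$. A zero $z_0$ of $f$ is called sense-preserving if $|r'(z_0)| > 1$, sense-reversing if $|r'(z_0)| < 1$, and singular if $|r'(z_0)| = 1$. Numbers of zeros count distinct points of $\mathbb{C}$. *)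

theory Defs
  imports "HOL-Analysis.Analysis" "HOL-Computational_Algebra.Polynomial"
begin

text \<open>
  A rational function \<open>r = p / q\<close> is represented by its numerator \<open>p\<close> and denominator \<open>q\<close>.
  Coprimality of \<open>p\<close> and \<open>q\<close> is not built into the definitions below and has to be assumed
  separately: only then are \<open>max (degree p) (degree q)\<close> the degree of \<open>r\<close> and the roots
  of \<open>q\<close> exactly the poles of \<open>r\<close>.
\<close>

definition rational_fun :: "complex poly \<Rightarrow> complex poly \<Rightarrow> complex \<Rightarrow> complex" where
  "rational_fun p q z = poly p z / poly q z"

definition rational_degree :: "complex poly \<Rightarrow> complex poly \<Rightarrow> nat" where
  "rational_degree p q = max (degree p) (degree q)"

definition rational_harmonic :: "complex poly \<Rightarrow> complex poly \<Rightarrow> complex \<Rightarrow> complex" where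
  "rational_harmonic p q z = rational_fun p q z - cnj z"

text \<open>
  The condition \<open>poly q z \<noteq> 0\<close> excludes the poles: since \<open>x / 0 = 0\<close>, a pole of \<open>r\<close> at the
  origin would otherwise count as a zero.
\<close>

definition harmonic_zeros :: "complex poly \<Rightarrow> complex poly \<Rightarrow> complex set" where
  "harmonic_zeros p q = {z. poly q z \<noteq> 0 \<and> rational_harmonic p q z = 0}"

definition sense_preserving_zeros :: "complex poly \<Rightarrow> complex poly \<Rightarrow> complex set" where
  "sense_preserving_zeros p q = {z \<in> harmonic_zeros p q. norm (deriv (rational_fun p q) z) > 1}"

definition sense_reversing_zeros :: "complex poly \<Rightarrow> complex poly \<Rightarrow> complex set" where
  "sense_reversing_zeros p q = {z \<in> harmonic_zeros p q. norm (deriv (rational_fun p q) z) < 1}"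

definition singular_zeros :: "complex poly \<Rightarrow> complex poly \<Rightarrow> complex set" where
  "singular_zeros p q = {z \<in> harmonic_zeros p q. norm (deriv (rational_fun p q) z) = 1}"

end

theory Submission
  imports Defs
    "HOL-Complex_Analysis.Complex_Analysis"
    "HOL-Computational_Algebra.Fundamental_Theorem_Algebra"
begin

text \<open>
  Zeros of \<open>r(z) - cnj z\<close> are the fixed points of the antiholomorphic map \<open>g = cnj \<circ> r\<close>, and the
  sense-reversing and singular ones are those which are attracting or parabolic. As in Fatou's theorem,
  each of them attracts a critical point of \<open>r\<close>: otherwise all inverse branches of the iterates of
  \<open>g \<circ> g\<close> exist on a disc or half-plane in which orbits converge. These branches omit an open
  part of another basin, so they are uniformly bounded after a Moebius map, and the Schwarz lemma forces
  them to identify two points that they keep apart. Since \<open>r\<close> has \<open>2n - 2\<close> critical points on the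
  sphere, there are at most \<open>2n - 2\<close> such zeros, and at most \<open>2n - 3\<close> finite ones when infinity
  is itself a non-repelling fixed point.

  If there are no singular zeros, the winding of \<open>p - cnj z * q\<close> around a large circle is the number of
  sense-preserving zeros minus the number of sense-reversing ones, which gives the bound for the former.
  Sense-preserving zeros persist under small perturbations, and \<open>r + c\<close> has no singular
  zeros for almost every constant \<open>c\<close>, which removes the regularity assumption.
\<close>

subsection \<open>Coverings and lifts\<close>

text \<open>Two facts shape the argument. At a fixed point \<open>w\<close> the multiplier of
  \<open>g \<circ> g\<close> is the square of the modulus of \<open>r'\<close> at \<open>w\<close>,
  a real number: every singular zero is parabolic with multiplier exactly 1, and irrational
  rotations never arise. Moreover, lifting inverse branches needs \<open>r\<close> to be a covering
  with a constant number of sheets in the plane. Fibres of finite values have all \<open>n\<close>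
  points in the plane only if infinity is not among them, hence the change of coordinate that moves
  a fixed point to infinity.

  Infinity also decides the last bound. If \<open>degree p > degree q\<close>, it is a fixed point
  whose multiplier has modulus \<open>norm (coeff q (n - 1)) / norm (lead_coeff p)\<close>. If it
  attracts, the winding there is \<open>n\<close> and at most \<open>2n - 3\<close> finite points
  are non-repelling, which allows \<open>3n - 3\<close> sense-preserving zeros. If it repels, the
  winding is \<open>n - 2\<close>, and \<open>2n - 2\<close> non-repelling points allow only
  \<open>3n - 4\<close>. Both sums are \<open>5n - 6\<close>.\<close>

lemma covering_space_holomorphic:
  assumes f: "f holomorphic_on E" and E: "open E" and df: "\<And>z. z \<in> E \<Longrightarrow> deriv f z \<noteq> 0"
    and im: "f ` E = B" and fib: "\<And>b. b \<in> B \<Longrightarrow> finite {z \<in> E. f z = b} \<and> card {z \<in> E. f z = b} = n"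
  shows "covering_space E f B"
proof
  show cont: "continuous_on E f" using f by (rule holomorphic_on_imp_continuous_on)
  show "f ` E = B" by (rule im)
  fix x assume x: "x \<in> B"
  define F where "F = {z \<in> E. f z = x}"
  have finF: "finite F" and cardF: "card F = n" using fib[OF x] by (auto simp: F_def)
  have neF: "F \<noteq> {}" using x im by (auto simp: F_def)
  obtain d where d: "d > 0" "\<And>a b. a \<in> F \<Longrightarrow> b \<in> F \<Longrightarrow> a \<noteq> b \<Longrightarrow> dist a b \<ge> 2 * d"
  proof -
    obtain e where e: "e > 0" "\<forall>a\<in>F. \<forall>b\<in>F. a \<noteq> b \<longrightarrow> e \<le> dist a b"
    proof -
      let ?D = "(\<lambda>(a,b). dist a b) ` {(a,b). a \<in> F \<and> b \<in> F \<and> a \<noteq> b}"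
      have "finite {(a,b). a \<in> F \<and> b \<in> F \<and> a \<noteq> b}"
        by (rule finite_subset[of _ "F \<times> F"]) (use finF in auto)
      then have fin: "finite (insert 1 ?D)" by simp
      have "Min (insert 1 ?D) > 0" using fin by (subst Min_gr_iff) auto
      moreover have "\<forall>a\<in>F. \<forall>b\<in>F. a \<noteq> b \<longrightarrow> Min (insert 1 ?D) \<le> dist a b"
        using fin by (auto intro!: Min_le)
      ultimately show ?thesis using that by blast
    qed
    show ?thesis by (rule that[of "e/2"]) (use e in auto)
  qed
  have "\<exists>r. r > 0 \<and> ball z r \<subseteq> E \<inter> ball z d \<and> open (f ` ball z r) \<and> inj_on f (ball z r)" if "z \<in> F" for z
  proof -
    have z: "z \<in> E" using that by (auto simp: F_def)
    obtain r where "r > 0" "ball z r \<subseteq> E \<inter> ball z d" "open (f ` ball z r)" "inj_on f (ball z r)"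
      by (rule has_complex_derivative_locally_invertible[of f "E \<inter> ball z d" z])
        (use z d E df f holomorphic_on_subset in auto)
    then show ?thesis by blast
  qed
  then obtain r where r: "\<And>z. z \<in> F \<Longrightarrow> r z > 0 \<and> ball z (r z) \<subseteq> E \<inter> ball z d
      \<and> open (f ` ball z (r z)) \<and> inj_on f (ball z (r z))"
    by metis
  have disj: "ball a (r a) \<inter> ball b (r b) = {}" if "a \<in> F" "b \<in> F" "a \<noteq> b" for a b
  proof -
    have "ball a d \<inter> ball b d = {}"
      using d(2)[OF that] by (intro disjoint_ballI) simp
    then show ?thesis using r[OF that(1)] r[OF that(2)] by blast
  qed
  \<comment> \<open>Over \<open>T\<close> every fibre meets each of the \<open>n\<close> disjoint
    discs. Having only \<open>n\<close> points, it has one in each disc and none elsewhere, so the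
    sets \<open>U z\<close> below exhaust the preimage of \<open>T\<close>.\<close>
  define T where "T = (\<Inter>z\<in>F. f ` ball z (r z))"
  have oT: "open T" unfolding T_def using finF r by (intro open_INT) auto
  have xT: "x \<in> T" unfolding T_def using r by (force simp: F_def)
  have TB: "T \<subseteq> B"
  proof -
    obtain z where "z \<in> F" using neF by blast
    then show ?thesis using r[of z] im by (force simp: T_def)
  qed
  define U where "U z = ball z (r z) \<inter> f -` T" for z
  have UE: "U z \<subseteq> E" if "z \<in> F" for z using r[OF that] by (auto simp: U_def)
  have oU: "open (U z)" if "z \<in> F" for z
  proof -
    have "continuous_on (ball z (r z)) f" using cont r[OF that] by (auto intro: continuous_on_subset)
    then show ?thesis unfolding U_def
      using oT continuous_on_open_vimage open_ball by (metis Int_commute)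
  qed
  have fU: "f ` U z = T" if "z \<in> F" for z
  proof -
    have "T \<subseteq> f ` ball z (r z)" using that by (auto simp: T_def)
    then show ?thesis by (auto simp: U_def)
  qed
  show "\<exists>T. x \<in> T \<and> openin (top_of_set B) T \<and>
          (\<exists>v. \<Union>v = E \<inter> f -` T \<and> (\<forall>u \<in> v. openin (top_of_set E) u) \<and>
               pairwise disjnt v \<and> (\<forall>u \<in> v. \<exists>q. homeomorphism u T f q))"
  proof (intro exI[of _ T] exI[of _ "U ` F"] conjI ballI)
    show "x \<in> T" by (rule xT)
    show "openin (top_of_set B) T" using oT TB by (auto simp: openin_open)
    show "\<Union> (U ` F) = E \<inter> f -` T"
    proof
      show "\<Union> (U ` F) \<subseteq> E \<inter> f -` T" using UE by (auto simp: U_def)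
      show "E \<inter> f -` T \<subseteq> \<Union> (U ` F)"
      proof
        fix y assume y: "y \<in> E \<inter> f -` T"
        have "\<forall>z\<in>F. \<exists>s. s \<in> U z \<and> f s = f y" using y fU by (metis IntD2 imageE vimageE)
        then obtain s where s: "\<And>z. z \<in> F \<Longrightarrow> s z \<in> U z \<and> f (s z) = f y" by metis
        have inj: "inj_on s F"
        proof (rule inj_onI, rule ccontr)
          fix a b assume "a \<in> F" "b \<in> F" "s a = s b" "a \<noteq> b"
          then show False using s[of a] s[of b] disj[of a b] by (auto simp: U_def)
        qed
        have fy: "f y \<in> B" using y im by blast
        have "s ` F = {z \<in> E. f z = f y}"
        proof (rule card_subset_eq)
          show "finite {z \<in> E. f z = f y}" using fib[OF fy] by simp
          show "s ` F \<subseteq> {z \<in> E. f z = f y}" using s UE by blast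
          show "card (s ` F) = card {z \<in> E. f z = f y}"
            using card_image[OF inj] cardF fib[OF fy] by simp
        qed
        then have "y \<in> s ` F" using y by auto
        then show "y \<in> \<Union> (U ` F)" using s by blast
      qed
    qed
    show "openin (top_of_set E) u" if "u \<in> U ` F" for u
      using that oU UE by (auto simp: openin_open)
    show "pairwise disjnt (U ` F)"
      unfolding pairwise_def disjnt_def using disj by (auto simp: U_def)
    show "\<exists>q. homeomorphism u T f q" if u: "u \<in> U ` F" for u
    proof -
      obtain z where z: "z \<in> F" "u = U z" using u by blast
      have "inj_on f (U z)" using r[OF z(1)] by (auto simp: U_def inj_on_def)
      moreover have "continuous_on (U z) f" using cont UE[OF z(1)] by (rule continuous_on_subset)
      ultimately obtain q where "homeomorphism (U z) (f ` U z) f q"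
        using invariance_of_domain_homeomorphism[of "U z" f] oU[OF z(1)] by auto
      then show ?thesis using z fU by auto
    qed
  qed
qed

section \<open>The antiholomorphic map, its basins and its fibres\<close>

definition conj_map :: "complex poly \<Rightarrow> complex poly \<Rightarrow> complex \<Rightarrow> complex" where
  "conj_map p q z = cnj (rational_fun p q z)"

text \<open>The numerator of the derivative of \<open>p / q\<close>, kept as a polynomial so that
  critical points can be counted by its degree.\<close>

definition wronskian :: "complex poly \<Rightarrow> complex poly \<Rightarrow> complex poly" where
  "wronskian p q = pderiv p * q - p * pderiv q"

text \<open>Orbits have to avoid the poles, where \<open>conj_map\<close> takes the junk value \<open>0\<close>.\<close>

definition basin :: "complex poly \<Rightarrow> complex poly \<Rightarrow> complex \<Rightarrow> complex set" where
  "basin p q w = {z. (\<forall>i. poly q ((conj_map p q ^^ i) z) \<noteq> 0) \<and> (\<lambda>i. (conj_map p q ^^ i) z) \<longlonglongrightarrow> w}"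

definition nonrepelling :: "complex poly \<Rightarrow> complex poly \<Rightarrow> complex set" where
  "nonrepelling p q = {z. poly q z \<noteq> 0 \<and> conj_map p q z = z \<and> norm (deriv (rational_fun p q) z) \<le> 1}"

lemma conj_map_eq_iff: "conj_map p q z = w \<longleftrightarrow> rational_fun p q z = cnj w"
  by (metis conj_map_def complex_cnj_cnj)

lemma rational_fun_has_deriv:
  assumes "poly q z \<noteq> 0"
  shows "(rational_fun p q has_field_derivative poly (wronskian p q) z / (poly q z)\<^sup>2) (at z)"
proof -
  have "((\<lambda>z. poly p z / poly q z) has_field_derivative poly (wronskian p q) z / (poly q z)\<^sup>2) (at z)"
    by (rule derivative_eq_intros refl poly_DERIV assms)+
      (simp add: wronskian_def power2_eq_square)
  then show ?thesis by (simp add: rational_fun_def[abs_def])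
qed

lemma deriv_rational_fun:
  "poly q z \<noteq> 0 \<Longrightarrow> deriv (rational_fun p q) z = poly (wronskian p q) z / (poly q z)\<^sup>2"
  by (rule DERIV_imp_deriv[OF rational_fun_has_deriv])

lemma rational_fun_holomorphic: "rational_fun p q holomorphic_on {z. poly q z \<noteq> 0}"
  by (subst holomorphic_on_open)
    (use rational_fun_has_deriv in \<open>auto intro!: open_Collect_neq continuous_intros\<close>)

lemma continuous_rational_fun: "poly q z \<noteq> 0 \<Longrightarrow> isCont (rational_fun p q) z"
  using rational_fun_has_deriv DERIV_isCont by blast

lemma continuous_conj_map: "poly q z \<noteq> 0 \<Longrightarrow> isCont (conj_map p q) z"
  unfolding conj_map_def[abs_def] by (intro isCont_cnj continuous_rational_fun)

text \<open>Backward invariance is what keeps lifts through \<open>conj_map p q\<close> inside the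
  basin.\<close>

lemma basin_backward: "poly q z \<noteq> 0 \<Longrightarrow> conj_map p q z \<in> basin p q w \<Longrightarrow> z \<in> basin p q w"
proof -
  assume q: "poly q z \<noteq> 0" and b: "conj_map p q z \<in> basin p q w"
  have *: "(conj_map p q ^^ Suc i) z = (conj_map p q ^^ i) (conj_map p q z)" for i
    by (simp add: funpow_swap1)
  have "poly q ((conj_map p q ^^ i) z) \<noteq> 0" for i
    using q b * by (cases i) (auto simp: basin_def simp del: funpow.simps(2))
  moreover have "(\<lambda>i. (conj_map p q ^^ i) z) \<longlonglongrightarrow> w"
    by (rule LIMSEQ_imp_Suc) (use b * in \<open>simp add: basin_def del: funpow.simps(2)\<close>)
  ultimately show ?thesis unfolding basin_def by blast
qed

lemma basin_forward: "z \<in> basin p q w \<Longrightarrow> conj_map p q z \<in> basin p q w"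
proof -
  assume b: "z \<in> basin p q w"
  have *: "(conj_map p q ^^ i) (conj_map p q z) = (conj_map p q ^^ Suc i) z" for i
    by (simp add: funpow_swap1)
  have "\<forall>i. poly q ((conj_map p q ^^ Suc i) z) \<noteq> 0" using b unfolding basin_def by blast
  moreover have "(\<lambda>i. (conj_map p q ^^ Suc i) z) \<longlonglongrightarrow> w"
    by (rule LIMSEQ_Suc) (use b in \<open>simp add: basin_def\<close>)
  ultimately show ?thesis unfolding basin_def mem_Collect_eq * by blast
qed

lemma basin_not_pole: "z \<in> basin p q w \<Longrightarrow> poly q z \<noteq> 0"
  using funpow_0[of "conj_map p q" z] by (auto simp: basin_def dest: spec[of _ 0])

lemma basin_disjoint: "z \<in> basin p q w \<Longrightarrow> z \<in> basin p q w' \<Longrightarrow> w = w'"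
  by (auto simp: basin_def intro: LIMSEQ_unique)

text \<open>The condition \<open>degree q < degree p\<close> says that \<open>\<infinity>\<close> is a fixed point, so that
  finite basins never meet it.\<close>

locale fixed_infinity =
  fixes p q :: "complex poly" and n :: nat
  assumes deg_p: "degree p = n" and deg_q: "degree q < n" and n_ge_2: "n \<ge> 2"
    and no_common_root: "\<And>z. poly p z \<noteq> 0 \<or> poly q z \<noteq> 0"
begin

lemma q_nonzero: "q \<noteq> 0"
proof
  assume "q = 0"
  moreover obtain z where "poly p z = 0"
    using fundamental_theorem_of_algebra[of p] deg_p n_ge_2 constant_degree[of p] by force
  ultimately show False using no_common_root[of z] by simp
qed

text \<open>The two products contribute \<open>n\<close> and \<open>degree q\<close> times the same
  number. As \<open>degree q < n\<close> they cannot cancel, so the Wronskian is not the zero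
  polynomial.\<close>

lemma wronskian_coeff: "coeff (wronskian p q) (n - 1 + degree q) = of_nat (n - degree q) * lead_coeff p * lead_coeff q"
proof -
  have dp: "degree (pderiv p) = n - 1" using deg_p by (simp add: degree_pderiv)
  have 1: "coeff (pderiv p * q) (n - 1 + degree q) = of_nat n * lead_coeff p * lead_coeff q"
    using coeff_mult_degree_sum[of "pderiv p" q] dp deg_p n_ge_2 by (simp add: coeff_pderiv)
  have 2: "coeff (p * pderiv q) (n - 1 + degree q) = of_nat (degree q) * lead_coeff p * lead_coeff q"
  \<comment> \<open>For constant \<open>q\<close> the subtraction in \<open>degree q - 1\<close>
    truncates, and the index is no longer the sum of the degrees of \<open>p\<close> and
    \<open>pderiv q\<close>.\<close>
  proof (cases "degree q = 0")
    case True
    then obtain c where "q = [:c:]" using degree_eq_zeroE by blast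
    then show ?thesis by simp
  next
    case False
    then have "n - 1 + degree q = degree p + degree (pderiv q)" using deg_p n_ge_2 by (simp add: degree_pderiv)
    then show ?thesis using coeff_mult_degree_sum[of p "pderiv q"] False
      by (simp add: degree_pderiv coeff_pderiv algebra_simps)
  qed
  show ?thesis unfolding wronskian_def using deg_q
    by (simp only: coeff_diff 1 2) (simp add: algebra_simps of_nat_diff)
qed

lemma wronskian_nonzero: "wronskian p q \<noteq> 0"
proof
  assume "wronskian p q = 0"
  then have "of_nat (n - degree q) * lead_coeff p * lead_coeff q = (0::complex)"
    using wronskian_coeff by simp
  moreover have "p \<noteq> 0" using deg_p n_ge_2 by auto
  moreover have "(of_nat (n - degree q) :: complex) \<noteq> 0" using deg_q by simp
  ultimately show False using q_nonzero by simp
qed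

text \<open>The fibre is the root set of \<open>p - smult w q\<close>, whose degree is
  \<open>n\<close> for every \<open>w\<close> because \<open>degree q < n\<close>. A double root
  would be a root of the Wronskian.\<close>

lemma fibre:
  assumes w: "\<And>z. poly q z \<noteq> 0 \<Longrightarrow> rational_fun p q z = w \<Longrightarrow> poly (wronskian p q) z \<noteq> 0"
  shows "finite {z. poly q z \<noteq> 0 \<and> rational_fun p q z = w}" (is "finite ?F")
    and "card {z. poly q z \<noteq> 0 \<and> rational_fun p q z = w} = n"
proof -
  define s where "s = p - smult w q"
  have roots: "?F = {z. poly s z = 0}"
    using no_common_root by (auto simp: s_def rational_fun_def field_simps)
  have degs: "degree s = n"
    unfolding s_def using deg_p deg_q degree_smult_le[of w q]
    by (simp only: diff_conv_add_uminus) (subst degree_add_eq_left; simp)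
  have s0: "s \<noteq> 0" using degs n_ge_2 by auto
  then show "finite ?F" using roots poly_roots_finite by simp
  have "rsquarefree s"
    unfolding rsquarefree_roots
  proof (intro allI notI)
    fix a assume a: "poly s a = 0 \<and> poly (pderiv s) a = 0"
    then have pa: "poly p a = w * poly q a" and pa': "poly (pderiv p) a = w * poly (pderiv q) a"
      by (auto simp: s_def pderiv_diff pderiv_smult)
    have "poly q a \<noteq> 0" using pa no_common_root[of a] by auto
    moreover have "rational_fun p q a = w" using pa calculation by (simp add: rational_fun_def)
    moreover have "poly (wronskian p q) a = 0" by (simp add: wronskian_def pa pa')
    ultimately show False using w by blast
  qed
  then have "smult (lead_coeff s) (\<Prod>z|poly s z = 0. [:-z, 1:]) = s"
    by (rule complex_poly_decompose_rsquarefree)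
  then have "degree s = degree (smult (lead_coeff s) (\<Prod>z|poly s z = 0. [:-z, 1:]))" by simp
  also have "\<dots> = degree (\<Prod>z|poly s z = 0. [:-z, 1:])" using s0 by (simp add: degree_smult_eq)
  also have "\<dots> = (\<Sum>z|poly s z = 0. degree [:-z, 1:])"
    by (rule degree_prod_sum_eq) simp
  also have "\<dots> = card {z. poly s z = 0}" by simp
  finally show "card ?F = n" using degs roots by simp
qed

definition critical_values :: "complex set" where
  "critical_values = rational_fun p q ` {z. poly q z \<noteq> 0 \<and> poly (wronskian p q) z = 0}"

lemma finite_critical_values: "finite critical_values"
  unfolding critical_values_def
  using poly_roots_finite[OF wronskian_nonzero] by (auto intro: finite_subset[of _ "{z. poly (wronskian p q) z = 0}"])

lemma covering_rational_fun:
  "covering_space {z. poly q z \<noteq> 0 \<and> rational_fun p q z \<notin> critical_values} (rational_fun p q) (- critical_values)"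
  (is "covering_space ?E ?r ?B")
proof (rule covering_space_holomorphic[where n = n])
  have fin: "finite {z. poly q z \<noteq> 0 \<and> ?r z = b}" and cardn: "card {z. poly q z \<noteq> 0 \<and> ?r z = b} = n"
    if "b \<in> ?B" for b
    using that fibre[of b] by (auto simp: critical_values_def)
  show "?r holomorphic_on ?E"
    by (rule holomorphic_on_subset[OF rational_fun_holomorphic]) auto
  have "open ({z. poly q z \<noteq> 0} \<inter> ?r -` (- critical_values))"
  proof (rule continuous_open_preimage)
    show "continuous_on {z. poly q z \<noteq> 0} ?r"
      using rational_fun_holomorphic by (rule holomorphic_on_imp_continuous_on)
    show "open {z. poly q z \<noteq> 0}" by (intro open_Collect_neq continuous_intros)
    show "open (- critical_values)" using finite_critical_values finite_imp_closed by blast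
  qed
  moreover have "{z. poly q z \<noteq> 0} \<inter> ?r -` (- critical_values) = ?E" by auto
  ultimately show "open ?E" by simp
  show "deriv ?r z \<noteq> 0" if "z \<in> ?E" for z
    using that deriv_rational_fun[of q z p] by (auto simp: critical_values_def)
  have eq: "{z \<in> ?E. ?r z = b} = {z. poly q z \<noteq> 0 \<and> ?r z = b}" if "b \<in> ?B" for b
    using that by auto
  show "finite {z \<in> ?E. ?r z = b} \<and> card {z \<in> ?E. ?r z = b} = n" if "b \<in> ?B" for b
    using fin cardn eq that by simp
  show "?r ` ?E = ?B"
  proof
    show "?B \<subseteq> ?r ` ?E"
    proof
      fix b assume b: "b \<in> ?B"
      then have "{z \<in> ?E. ?r z = b} \<noteq> {}" using cardn[OF b] eq[OF b] n_ge_2 by (metis card.empty not_numeral_le_zero)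
      then show "b \<in> ?r ` ?E" by blast
    qed
  qed auto
qed

text \<open>One step of building inverse branches. Without critical points in the basin, no
  conjugate of a basin point is a critical value, so \<open>cnj \<circ> S\<close> lifts through the
  covering over the convex set \<open>H\<close>. Uniqueness of lifts spreads the normalisation at
  \<open>u0\<close> to all of \<open>H\<close>.\<close>

lemma lift:
  fixes S \<tau> \<Phi> :: "complex \<Rightarrow> complex"
  assumes nocrit: "\<And>z. z \<in> basin p q w \<Longrightarrow> poly (wronskian p q) z \<noteq> 0"
    and H: "convex H" "u0 \<in> H"
    and S: "continuous_on H S" "S ` H \<subseteq> basin p q w"
    and \<tau>: "continuous_on H \<tau>" "\<tau> ` H \<subseteq> basin p q w"
    and \<Phi>: "continuous_on H \<Phi>" "\<Phi> ` H \<subseteq> H"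
    and eq: "\<And>u. u \<in> H \<Longrightarrow> conj_map p q (\<tau> u) = S (\<Phi> u)"
  obtains S' where "continuous_on H S'" "S' ` H \<subseteq> basin p q w"
    "\<And>u. u \<in> H \<Longrightarrow> conj_map p q (S' u) = S u" "\<And>u. u \<in> H \<Longrightarrow> S' (\<Phi> u) = \<tau> u"
proof -
  let ?E = "{z. poly q z \<noteq> 0 \<and> rational_fun p q z \<notin> critical_values}"
  have notcv: "cnj z \<notin> critical_values" if "z \<in> basin p q w" for z
  proof
    assume "cnj z \<in> critical_values"
    then obtain c where c: "poly q c \<noteq> 0" "poly (wronskian p q) c = 0" "cnj z = rational_fun p q c"
      by (auto simp: critical_values_def)
    have "conj_map p q c = z" using c(3) by (simp add: conj_map_eq_iff)
    then have "c \<in> basin p q w" using basin_backward[OF c(1), of p w] that by simp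
    then show False using nocrit c(2) by blast
  qed
  have \<tau>E: "\<tau> u \<in> ?E" if "u \<in> H" for u
  proof -
    have "\<tau> u \<in> basin p q w" using \<tau> that by blast
    then have "poly q (\<tau> u) \<noteq> 0" "cnj (conj_map p q (\<tau> u)) \<notin> critical_values"
      using basin_not_pole notcv[OF basin_forward] by auto
    then show ?thesis by (simp add: conj_map_def)
  qed
  have r\<tau>: "rational_fun p q (\<tau> u) = cnj (S (\<Phi> u))" if "u \<in> H" for u
    using eq[OF that] by (simp add: conj_map_eq_iff)
  obtain S' where S': "continuous_on H S'" "S' \<in> H \<rightarrow> ?E" "S' (\<Phi> u0) = \<tau> u0"
    "\<And>u. u \<in> H \<Longrightarrow> rational_fun p q (S' u) = cnj (S u)"
  proof (rule covering_space_lift_strong[OF covering_rational_fun, of "\<tau> u0" "\<Phi> u0" H "\<lambda>u. cnj (S u)"])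
    show "\<tau> u0 \<in> ?E" "\<Phi> u0 \<in> H" using \<tau>E H \<Phi> by blast+
    show "simply_connected H" using H by (intro convex_imp_simply_connected)
    show "locally path_connected H" using H by (intro convex_imp_locally_path_connected)
    show "continuous_on H (\<lambda>u. cnj (S u))" using S by (intro continuous_intros)
    show "(\<lambda>u. cnj (S u)) \<in> H \<rightarrow> - critical_values" using S notcv by auto
    show "cnj (S (\<Phi> u0)) = rational_fun p q (\<tau> u0)" using r\<tau> H by simp
  qed auto
  have gS': "conj_map p q (S' u) = S u" if "u \<in> H" for u
    using S'(4)[OF that] by (simp add: conj_map_def)
  have im: "S' ` H \<subseteq> basin p q w"
  proof
    fix x assume "x \<in> S' ` H"
    then obtain u where u: "u \<in> H" "x = S' u" by blast
    then show "x \<in> basin p q w"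
      using S'(2) S(2) gS'[OF u(1)] basin_backward[of q "S' u" p w] by auto
  qed
  have lift_eq: "S' (\<Phi> u) = \<tau> u" if u: "u \<in> H" for u
  proof -
    have 1: "continuous_on H (\<lambda>u. cnj (S (\<Phi> u)))"
      by (intro continuous_intros continuous_on_compose2[OF S(1)] \<Phi>)
    have 2: "continuous_on H (\<lambda>u. S' (\<Phi> u))" by (intro continuous_on_compose2[OF S'(1)] \<Phi>)
    have 3: "(\<lambda>u. cnj (S (\<Phi> u))) \<in> H \<rightarrow> - critical_values" using S(2) notcv \<Phi>(2) by blast
    have 4: "(\<lambda>u. S' (\<Phi> u)) \<in> H \<rightarrow> ?E" using S'(2) \<Phi> by auto
    have 5: "\<tau> \<in> H \<rightarrow> ?E" using \<tau>E by auto
    have 6: "connected H" using H by (intro convex_connected)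
    have 7: "cnj (S (\<Phi> u)) = rational_fun p q (S' (\<Phi> u))" if "u \<in> H" for u
      using S'(4)[of "\<Phi> u"] \<Phi> that by auto
    have 8: "cnj (S (\<Phi> u)) = rational_fun p q (\<tau> u)" if "u \<in> H" for u
      using r\<tau>[OF that] by simp
    show ?thesis
      by (rule covering_space_lift_unique[OF covering_rational_fun _ 1 3 2 4 7 \<tau>(1) 5 8 6 H(2) u])
        (use S'(3) in auto)
  qed
  show ?thesis by (rule that[OF S'(1) im gS' lift_eq])
qed

end

subsection \<open>Charts with converging orbits and critical points\<close>

lemma conj_map2_has_deriv:
  assumes "poly q z \<noteq> 0" "poly q (conj_map p q z) \<noteq> 0"
  shows "((\<lambda>z. conj_map p q (conj_map p q z)) has_field_derivative
           cnj (deriv (rational_fun p q) (conj_map p q z)) * deriv (rational_fun p q) z) (at z)"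
proof -
  let ?r = "rational_fun p q"
  \<comment> \<open>The two conjugations pair up around the outer copy of \<open>r\<close>, so the
    second iterate is holomorphic.\<close>
  have eq: "(\<lambda>z. conj_map p q (conj_map p q z)) = (\<lambda>z. (cnj \<circ> ?r \<circ> cnj) (?r z))"
    by (auto simp: conj_map_def fun_eq_iff)
  have 1: "(?r has_field_derivative deriv ?r z) (at z)"
    using rational_fun_has_deriv[OF assms(1)] deriv_rational_fun[OF assms(1)] by simp
  have "(?r has_field_derivative deriv ?r (conj_map p q z)) (at (cnj (?r z)))"
    using rational_fun_has_deriv[OF assms(2)] deriv_rational_fun[OF assms(2)] by (simp add: conj_map_def)
  then have "(cnj \<circ> ?r \<circ> cnj has_field_derivative cnj (deriv ?r (conj_map p q z))) (at (?r z))"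
    using has_field_derivative_cnj_cnj[of ?r "deriv ?r (conj_map p q z)" "?r z"] by simp
  from DERIV_chain2[OF this 1] show ?thesis by (simp add: eq)
qed

text \<open>Covering theory yields only continuous lifts. The difference quotient of
  \<open>S'\<close> is that of \<open>S\<close> divided by the Caratheodory slope of
  \<open>Q\<close>, which tends to the nonzero derivative of \<open>Q\<close>.\<close>

lemma holomorphic_lift:
  assumes H: "open H" and S': "continuous_on H S'" and S: "S holomorphic_on H"
    and eq: "\<And>u. u \<in> H \<Longrightarrow> Q (S' u) = S u"
    and Q: "\<And>u. u \<in> H \<Longrightarrow> \<exists>d. d \<noteq> 0 \<and> (Q has_field_derivative d) (at (S' u))"
  shows "S' holomorphic_on H"
  unfolding holomorphic_on_open[OF H]
proof
  fix u assume u: "u \<in> H"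
  obtain d where d: "d \<noteq> 0" "(Q has_field_derivative d) (at (S' u))" using Q[OF u] by blast
  obtain \<phi> where \<phi>: "\<And>z. Q z - Q (S' u) = \<phi> z * (z - S' u)" "isCont \<phi> (S' u)" "\<phi> (S' u) = d"
    using d(2) unfolding CARAT_DERIV by blast
  obtain e where e: "(S has_field_derivative e) (at u)"
    using S u unfolding holomorphic_on_open[OF H] by blast
  have cS': "isCont S' u" using S' H u by (simp add: continuous_on_eq_continuous_at)
  have lim: "(\<lambda>v. \<phi> (S' v)) \<midarrow>u\<rightarrow> d"
    using isCont_o2[OF cS' \<phi>(2)] \<phi>(3) by (simp add: isCont_def)
  have quot: "((\<lambda>v. (S v - S u) / (v - u) / \<phi> (S' v)) \<longlongrightarrow> e / d) (at u)"
    using e d(1) lim by (intro tendsto_divide) (auto simp: has_field_derivative_iff)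
  have "\<forall>\<^sub>F v in at u. v \<in> H \<and> v \<noteq> u"
    using eventually_at_in_open[OF H u] by (auto elim: eventually_mono)
  moreover have "\<forall>\<^sub>F v in at u. \<phi> (S' v) \<noteq> 0"
    using lim d(1) by (rule tendsto_imp_eventually_ne)
  ultimately have "\<forall>\<^sub>F v in at u. (S v - S u) / (v - u) / \<phi> (S' v) = (S' v - S' u) / (v - u)"
  proof eventually_elim
    case (elim v)
    then have "S v - S u = \<phi> (S' v) * (S' v - S' u)" using \<phi>(1)[of "S' v"] eq u by simp
    then show ?case using elim by simp
  qed
  from Lim_transform_eventually[OF quot this]
  have "((\<lambda>v. (S' v - S' u) / (v - u)) \<longlongrightarrow> e / d) (at u)" .
  then show "\<exists>f'. (S' has_field_derivative f') (at u)"
    by (auto simp: has_field_derivative_iff)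
qed

lemma bounded_holomorphic_dist:
  assumes T: "T holomorphic_on ball a \<rho>" and B: "\<And>z. z \<in> ball a \<rho> \<Longrightarrow> norm (T z) \<le> B" "B > 0"
    and b: "b \<in> ball a \<rho>"
  shows "norm (T b - T a) \<le> 3 * B * dist a b / \<rho>"
proof -
  have \<rho>: "\<rho> > 0" using b by (metis dist_not_less_zero linorder_cases mem_ball order.strict_trans)
  have inb: "a + of_real \<rho> * z \<in> ball a \<rho>" if "norm z < 1" for z :: complex
    using that \<rho> by (simp add: dist_norm norm_mult)
  \<comment> \<open>The difference is at most \<open>2 * B\<close>; dividing by \<open>3 * B\<close>
    gives the strict bound that the Schwarz lemma requires.\<close>
  define f where "f z = (T (a + of_real \<rho> * z) - T a) / of_real (3 * B)" for z
  define \<xi> where "\<xi> = (b - a) / of_real \<rho>"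
  have \<xi>: "norm \<xi> = dist a b / \<rho>" using \<rho> by (simp add: \<xi>_def norm_divide dist_norm norm_minus_commute)
  have "norm (f \<xi>) \<le> norm \<xi>"
  proof (rule Schwarz_Lemma(1))
    show "f holomorphic_on ball 0 1"
      unfolding f_def
      by (intro holomorphic_intros holomorphic_on_compose_gen[OF _ T, unfolded o_def])
        (use B inb in \<open>auto\<close>)
    show "f 0 = 0" by (simp add: f_def)
    show "norm (f z) < 1" if "norm z < 1" for z
    proof -
      have "norm (T (a + of_real \<rho> * z) - T a) \<le> B + B"
        using B(1)[OF inb[OF that]] B(1)[of a] \<rho> by (intro order_trans[OF norm_triangle_ineq4] add_mono) auto
      then show ?thesis using B(2) by (simp add: f_def norm_divide norm_mult)
    qed
    show "norm \<xi> < 1" using b \<rho> by (simp add: \<xi>)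
  qed
  moreover have "a + of_real \<rho> * \<xi> = b" using \<rho> by (simp add: \<xi>_def)
  ultimately have "norm (T b - T a) / (3 * B) \<le> dist a b / \<rho>"
    using B(2) unfolding \<xi> by (simp add: f_def norm_divide norm_mult)
  then show ?thesis using B(2) by (simp add: field_simps)
qed

context fixed_infinity
begin

text \<open>A chart \<open>\<sigma>\<close> in which points \<open>a\<close>, \<open>b\<close> are iterated hyperbolically together: the inverse
  branches of the iterates would be normal and yet keep \<open>\<sigma> a\<close> and \<open>\<sigma> b\<close> apart.\<close>

lemma attracting_chart_imp_critical:
  fixes \<sigma> F :: "complex \<Rightarrow> complex"
  assumes H: "open H" "convex H" and \<sigma>: "\<sigma> holomorphic_on H" "\<sigma> ` H \<subseteq> basin p q w"
    and F: "continuous_on H F" "F ` H \<subseteq> H"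
    and conj: "\<And>u. u \<in> H \<Longrightarrow> conj_map p q (conj_map p q (\<sigma> u)) = \<sigma> (F u)"
    and ab: "a \<in> H" "b \<in> H" "\<sigma> a \<noteq> \<sigma> b"
    and close: "\<And>e. e > 0 \<Longrightarrow> \<exists>k \<rho>. \<rho> > 0 \<and> ball ((F ^^ k) a) \<rho> \<subseteq> H \<and> dist ((F ^^ k) a) ((F ^^ k) b) < e * \<rho>"
    and W: "open W" "W \<noteq> {}" "W \<inter> basin p q w = {}"
  shows "\<exists>c\<in>basin p q w. poly (wronskian p q) c = 0"
proof (rule ccontr)
  let ?g = "conj_map p q"
  assume "\<not> ?thesis"
  then have nocrit: "poly (wronskian p q) z \<noteq> 0" if "z \<in> basin p q w" for z using that by blast
  have Fk: "continuous_on H (F ^^ k)" "(F ^^ k) ` H \<subseteq> H" for k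
  proof (induction k)
    case (Suc k)
    { case 1 show ?case using continuous_on_compose2[OF F(1) Suc(1) Suc(2)] by (simp add: o_def) }
    { case 2 show ?case using Suc(2) F(2) by auto }
  qed auto
  have \<sigma>c: "continuous_on H \<sigma>" using \<sigma>(1) by (rule holomorphic_on_imp_continuous_on)
  have Qd: "\<exists>d. d \<noteq> 0 \<and> ((\<lambda>z. ?g (?g z)) has_field_derivative d) (at z)" if z: "z \<in> basin p q w" for z
  proof -
    have "deriv (rational_fun p q) x \<noteq> 0" if "x \<in> basin p q w" for x
      using nocrit[OF that] basin_not_pole[OF that] by (simp add: deriv_rational_fun)
    from this[OF z] this[OF basin_forward[OF z]] show ?thesis
      using conj_map2_has_deriv[OF basin_not_pole[OF z] basin_not_pole[OF basin_forward[OF z]]]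
      by (intro exI conjI) auto
  qed
  have "\<exists>S. S holomorphic_on H \<and> S ` H \<subseteq> basin p q w \<and> (\<forall>u\<in>H. S ((F ^^ k) u) = \<sigma> u)" for k
  proof (induction k)
    case 0
    show ?case using \<sigma> by (intro exI[of _ \<sigma>]) auto
  next
    case (Suc k)
    then obtain S where S: "S holomorphic_on H" "S ` H \<subseteq> basin p q w"
      "\<And>u. u \<in> H \<Longrightarrow> S ((F ^^ k) u) = \<sigma> u" by blast
    have Sc: "continuous_on H S" using S(1) by (rule holomorphic_on_imp_continuous_on)
    \<comment> \<open>Each step lifts twice, since \<open>F\<close> corresponds to
      \<open>g \<circ> g\<close>. The intermediate \<open>S1\<close> is normalised by the half step
      \<open>?g (\<sigma> u)\<close> and is only known to be continuous; holomorphy is recovered for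
      \<open>S2\<close>.\<close>
    obtain S1 where S1: "continuous_on H S1" "S1 ` H \<subseteq> basin p q w"
      "\<And>u. u \<in> H \<Longrightarrow> ?g (S1 u) = S u" "\<And>u. u \<in> H \<Longrightarrow> S1 ((F ^^ Suc k) u) = ?g (\<sigma> u)"
    proof (rule lift[OF nocrit H(2) ab(1) Sc S(2) _ _ Fk, of "\<lambda>u. ?g (\<sigma> u)" "Suc k"])
      have "isCont ?g (\<sigma> u)" if "u \<in> H" for u using \<sigma>(2) that basin_not_pole by (intro continuous_conj_map) blast
      then have "continuous_on (\<sigma> ` H) ?g" by (auto simp: continuous_at_imp_continuous_on)
      then show "continuous_on H (\<lambda>u. ?g (\<sigma> u))" by (intro continuous_on_compose2[OF _ \<sigma>c]) auto
      show "(\<lambda>u. ?g (\<sigma> u)) ` H \<subseteq> basin p q w" using \<sigma>(2) basin_forward by blast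
      show "?g (?g (\<sigma> u)) = S ((F ^^ Suc k) u)" if "u \<in> H" for u
        using conj[OF that] S(3)[of "F u"] F(2) that by (simp add: funpow_swap1 image_subset_iff)
    qed blast+
    obtain S2 where S2: "continuous_on H S2" "S2 ` H \<subseteq> basin p q w"
      "\<And>u. u \<in> H \<Longrightarrow> ?g (S2 u) = S1 u" "\<And>u. u \<in> H \<Longrightarrow> S2 ((F ^^ Suc k) u) = \<sigma> u"
      by (rule lift[OF nocrit H(2) ab(1) S1(1,2) \<sigma>c \<sigma>(2) Fk, of "Suc k"]) (use S1(4) in auto)
    have "S2 holomorphic_on H"
      by (rule holomorphic_lift[OF H(1) S2(1) S(1), of "\<lambda>z. ?g (?g z)"]) (use S1(3) S2 Qd in auto)
    then show ?case using S2 by blast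
  qed
  then obtain S where S: "\<And>k. S k holomorphic_on H" "\<And>k. S k ` H \<subseteq> basin p q w"
    "\<And>k u. u \<in> H \<Longrightarrow> S k ((F ^^ k) u) = \<sigma> u" by metis
  \<comment> \<open>All branches omit the disc about \<open>c\<close>, so
    \<open>1 / (S k - c)\<close> is bounded by \<open>1 / \<epsilon>\<close> uniformly in
    \<open>k\<close>.\<close>
  obtain c \<epsilon> where c: "\<epsilon> > 0" "ball c \<epsilon> \<subseteq> W" using W by (metis ex_in_conv openE)
  have away: "\<epsilon> \<le> norm (x - c)" if "x \<in> basin p q w" for x
  proof -
    have "x \<notin> ball c \<epsilon>" using c that W by blast
    then show ?thesis by (simp add: dist_norm norm_minus_commute)
  qed
  have away': "x \<noteq> c" if "x \<in> basin p q w" for x using away[OF that] c(1) by auto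
  define \<delta> where "\<delta> = norm (1 / (\<sigma> b - c) - 1 / (\<sigma> a - c))"
  have \<delta>: "\<delta> > 0"
  proof -
    have "\<sigma> a \<noteq> c" "\<sigma> b \<noteq> c" using \<sigma>(2) ab away' by blast+
    then have "1 / (\<sigma> b - c) \<noteq> 1 / (\<sigma> a - c)" using ab(3) by (auto simp: field_simps)
    then show ?thesis by (simp add: \<delta>_def)
  qed
  \<comment> \<open>The bound 1 puts the second point into the disc of radius \<open>\<rho>\<close>.
    The bound \<open>\<delta> * \<epsilon> / 3\<close> brings the Schwarz estimate below
    \<open>\<delta>\<close>, the separation of the images of \<open>\<sigma> a\<close> and
    \<open>\<sigma> b\<close>, which does not depend on \<open>k\<close>.\<close>
  obtain k \<rho> where k: "\<rho> > 0" "ball ((F ^^ k) a) \<rho> \<subseteq> H"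
    "dist ((F ^^ k) a) ((F ^^ k) b) < min 1 (\<delta> * \<epsilon> / 3) * \<rho>"
    using close[of "min 1 (\<delta> * \<epsilon> / 3)"] \<delta> c by auto
  have d1: "dist ((F ^^ k) a) ((F ^^ k) b) < \<rho>" 
    using k(3) mult_right_mono[of "min 1 (\<delta> * \<epsilon> / 3)" 1 \<rho>] k(1) by linarith
  have d2: "dist ((F ^^ k) a) ((F ^^ k) b) < \<delta> * \<epsilon> / 3 * \<rho>" 
    using k(3) mult_right_mono[of "min 1 (\<delta> * \<epsilon> / 3)" "\<delta> * \<epsilon> / 3" \<rho>] k(1) by linarith
  have inB: "S k z \<in> basin p q w" if "z \<in> ball ((F ^^ k) a) \<rho>" for z
    using subsetD[OF k(2) that] S(2)[of k] by (simp add: image_subset_iff)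
  let ?T = "\<lambda>u. 1 / (S k u - c)"
  have "norm (?T ((F ^^ k) b) - ?T ((F ^^ k) a)) \<le> 3 * (1 / \<epsilon>) * dist ((F ^^ k) a) ((F ^^ k) b) / \<rho>"
  proof (rule bounded_holomorphic_dist)
    show "?T holomorphic_on ball ((F ^^ k) a) \<rho>"
      by (intro holomorphic_intros holomorphic_on_subset[OF S(1)] k(2))
        (use inB away' in auto)
    show "norm (?T z) \<le> 1 / \<epsilon>" if "z \<in> ball ((F ^^ k) a) \<rho>" for z
    proof -
      from away[OF inB[OF that]] show ?thesis using c(1) by (simp add: norm_divide frac_le)
    qed
    show "1 / \<epsilon> > 0" using c by simp
    show "(F ^^ k) b \<in> ball ((F ^^ k) a) \<rho>" using d1 by simp
  qed
  then have "\<delta> \<le> 3 * dist ((F ^^ k) a) ((F ^^ k) b) / (\<epsilon> * \<rho>)"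
    using S(3)[of _ k] ab by (simp add: \<delta>_def)
  also have "\<dots> < \<delta>" using d2 c(1) k(1) by (simp add: field_simps)
  finally show False by simp
qed

end

subsection \<open>Charts at non-repelling fixed points\<close>

text \<open>A common interface for attracting points (\<open>H\<close> a disc) and parabolic ones
  (\<open>H\<close> a half-plane). The last clause bounds the hyperbolic distance of the two orbits
  in \<open>H\<close> without introducing the hyperbolic metric.\<close>

definition attracting_chart ::
  "complex poly \<Rightarrow> complex poly \<Rightarrow> complex \<Rightarrow> complex set \<Rightarrow> (complex \<Rightarrow> complex) \<Rightarrow> (complex \<Rightarrow> complex) \<Rightarrow> complex \<Rightarrow> complex \<Rightarrow> bool"
  where "attracting_chart p q w H \<sigma> F a b \<longleftrightarrow>
    open H \<and> convex H \<and> \<sigma> holomorphic_on H \<and> \<sigma> ` H \<subseteq> basin p q w \<and>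
    continuous_on H F \<and> F ` H \<subseteq> H \<and> (\<forall>u\<in>H. conj_map p q (conj_map p q (\<sigma> u)) = \<sigma> (F u)) \<and>
    a \<in> H \<and> b \<in> H \<and> \<sigma> a \<noteq> \<sigma> b \<and>
    (\<forall>e>0. \<exists>k \<rho>. \<rho> > 0 \<and> ball ((F ^^ k) a) \<rho> \<subseteq> H \<and> dist ((F ^^ k) a) ((F ^^ k) b) < e * \<rho>)"

lemma LIMSEQ_even_odd:
  fixes f :: "nat \<Rightarrow> 'a::metric_space"
  assumes "(\<lambda>k. f (2 * k)) \<longlonglongrightarrow> l" "(\<lambda>k. f (2 * k + 1)) \<longlonglongrightarrow> l"
  shows "f \<longlonglongrightarrow> l"
proof (rule metric_LIMSEQ_I)
  fix e :: real assume "e > 0"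
  then obtain K L where K: "\<And>k. k \<ge> K \<Longrightarrow> dist (f (2 * k)) l < e" and L: "\<And>k. k \<ge> L \<Longrightarrow> dist (f (2 * k + 1)) l < e"
    using assms metric_LIMSEQ_D by metis
  have "dist (f i) l < e" if "i \<ge> 2 * (K + L) + 1" for i
  proof (cases "even i")
    case True
    then obtain k where "i = 2 * k" by (elim evenE)
    then show ?thesis using K[of k] that by simp
  next
    case False
    then obtain k where "i = 2 * k + 1" by (elim oddE)
    then show ?thesis using L[of k] that by simp
  qed
  then show "\<exists>no. \<forall>i\<ge>no. dist (f i) l < e" by blast
qed

lemma nonpole_neighbourhood:
  fixes q :: "complex poly"
  assumes "poly q w \<noteq> 0"
  obtains d where "d > 0" "\<And>z. dist z w < d \<Longrightarrow> poly q z \<noteq> 0"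
proof -
  have "open {z. poly q z \<noteq> 0}" by (intro open_Collect_neq continuous_intros)
  then obtain d where "d > 0" "ball w d \<subseteq> {z. poly q z \<noteq> 0}" using assms openE by blast
  then show ?thesis using that[of d] by (auto simp: dist_commute subset_iff)
qed

text \<open>Near \<open>w\<close> the map contracts by a factor \<open>\<mu>\<close> strictly
  between the modulus of the derivative and 1. The chart is the identity on a disc, and with
  \<open>a = w\<close> fixed the same radius serves every iterate.\<close>

lemma attracting_chart_of_attracting:
  assumes w: "poly q w \<noteq> 0" "conj_map p q w = w" and d: "norm (deriv (rational_fun p q) w) < 1"
  shows "\<exists>H \<sigma> F a b. attracting_chart p q w H \<sigma> F a b"
proof -
  let ?r = "rational_fun p q" and ?g = "conj_map p q"
  define D where "D = deriv ?r w"
  obtain \<mu> where \<mu>: "norm D < \<mu>" "\<mu> < 1" using d dense D_def by blast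
  have \<mu>0: "\<mu> > 0" using \<mu>(1) norm_ge_zero[of D] by linarith
  have "(?r has_derivative (*) D) (at w)"
    using rational_fun_has_deriv[OF w(1), of p] deriv_rational_fun[OF w(1), of p]
    by (simp add: has_field_derivative_def D_def)
  then obtain d1 where d1: "d1 > 0" "\<And>z. norm (z - w) < d1 \<Longrightarrow> norm (?r z - ?r w - D * (z - w)) \<le> (\<mu> - norm D) * norm (z - w)"
    unfolding has_derivative_at_alt using \<mu>(1) by (metis diff_gt_0_iff_gt)
  obtain d2 where d2: "d2 > 0" "\<And>z. dist z w < d2 \<Longrightarrow> poly q z \<noteq> 0"
    using nonpole_neighbourhood[OF w(1)] by blast
  define \<delta> where "\<delta> = min d1 d2"
  have \<delta>: "\<delta> > 0" using d1 d2 by (simp add: \<delta>_def)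
  have contr: "norm (?g z - w) \<le> \<mu> * norm (z - w)" if "norm (z - w) < \<delta>" for z
  proof -
    have "norm (?g z - w) = norm (cnj (?r z - ?r w))"
      using w(2) by (simp add: conj_map_def)
    also have "\<dots> = norm (?r z - ?r w)" by (rule complex_mod_cnj)
    also have "\<dots> \<le> norm (?r z - ?r w - D * (z - w)) + norm (D * (z - w))"
      using norm_triangle_ineq[of "?r z - ?r w - D * (z - w)" "D * (z - w)"] by simp
    also have "\<dots> \<le> (\<mu> - norm D) * norm (z - w) + norm D * norm (z - w)"
      using d1(2)[of z] that by (simp add: \<delta>_def norm_mult)
    finally show ?thesis by (simp add: algebra_simps)
  qed
  have iter: "norm ((?g ^^ i) z - w) \<le> \<mu> ^ i * norm (z - w) \<and> norm ((?g ^^ i) z - w) < \<delta>"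
    if z: "norm (z - w) < \<delta>" for z i
  proof (induction i)
    case (Suc i)
    have "norm ((?g ^^ Suc i) z - w) \<le> \<mu> * norm ((?g ^^ i) z - w)" using contr Suc by simp
    moreover have "\<mu> * norm ((?g ^^ i) z - w) \<le> \<mu> * (\<mu> ^ i * norm (z - w))"
      using Suc \<mu>0 by (intro mult_left_mono) auto
    moreover have "\<mu> * norm ((?g ^^ i) z - w) \<le> 1 * norm ((?g ^^ i) z - w)"
      using \<mu> by (intro mult_right_mono) auto
    ultimately show ?case using Suc by (auto simp: mult.assoc)
  qed (use z in auto)
  have \<mu>lim: "(\<lambda>i. \<mu> ^ i * K) \<longlonglongrightarrow> 0" for K
    using tendsto_mult_left_zero[OF LIMSEQ_realpow_zero[of \<mu>]] \<mu> \<mu>0 by simp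
  have lim: "(\<lambda>i. (?g ^^ i) z) \<longlonglongrightarrow> w" if z: "norm (z - w) < \<delta>" for z
  proof (rule LIM_zero_cancel, rule Lim_null_comparison)
    show "\<forall>\<^sub>F i in sequentially. norm ((?g ^^ i) z - w) \<le> \<mu> ^ i * norm (z - w)"
      using iter[OF z] by simp
    show "(\<lambda>i. \<mu> ^ i * norm (z - w)) \<longlonglongrightarrow> 0" by (rule \<mu>lim)
  qed
  let ?H = "ball w \<delta>" and ?F = "\<lambda>z. ?g (?g z)" and ?b = "w + of_real (\<delta> / 2)"
  have F: "(?F ^^ k) z = (?g ^^ (2 * k)) z" for k z
    by (induction k) auto
  have H: "z \<in> ?H \<longleftrightarrow> norm (z - w) < \<delta>" for z by (simp add: dist_norm norm_minus_commute)
  have inH: "?g z \<in> ?H" if "z \<in> ?H" for z using iter[of z 1] that H by simp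
  have fw: "(?F ^^ k) w = w" for k using w(2) by (induction k) auto
  have bH: "?b \<in> ?H" using \<delta> by (simp add: dist_norm)
  have "attracting_chart p q w ?H id ?F w ?b"
    unfolding attracting_chart_def
  proof (intro conjI ballI allI impI)
    show "id ` ?H \<subseteq> basin p q w"
      unfolding basin_def using lim iter H d2(2) by (auto simp: \<delta>_def dist_norm)
    have "continuous_on ?H ?g"
      using continuous_conj_map d2 by (intro continuous_at_imp_continuous_on) (auto simp: \<delta>_def dist_commute)
    then show "continuous_on ?H ?F" by (rule continuous_on_compose2) (use \<open>continuous_on ?H ?g\<close> inH in auto)
    show "?F ` ?H \<subseteq> ?H" using inH by blast
    show "id w \<noteq> id ?b" using \<delta> by simp
    show "w \<in> ?H" using \<delta> by simp
    show "?b \<in> ?H" by (rule bH)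
    fix e :: real assume e: "e > 0"
    have "(\<lambda>i. (?g ^^ i) ?b) \<longlonglongrightarrow> w" using lim bH H by blast
    then have "\<forall>\<^sub>F i in sequentially. dist ((?g ^^ i) ?b) w < e * \<delta>"
      using e \<delta> by (intro tendstoD) auto
    then obtain k where k: "\<forall>i\<ge>k. dist ((?g ^^ i) ?b) w < e * \<delta>" by (auto simp: eventually_sequentially)
    show "\<exists>k \<rho>. \<rho> > 0 \<and> ball ((?F ^^ k) w) \<rho> \<subseteq> ?H \<and> dist ((?F ^^ k) w) ((?F ^^ k) ?b) < e * \<rho>"
    proof (intro exI conjI)
      show "dist ((?F ^^ k) w) ((?F ^^ k) ?b) < e * \<delta>"
        using k[rule_format, of "2 * k"] by (simp only: fw) (simp only: F dist_commute)
    qed (use \<delta> fw in auto)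
  qed auto
  then show ?thesis by blast
qed

context fixed_infinity
begin

text \<open>By the identity theorem, \<open>g \<circ> g = id\<close> would spread to the plane minus
  finitely many points and make \<open>r\<close> injective there, while a generic fibre has
  \<open>n \<ge> 2\<close> points.\<close>

lemma second_iterate_nonconstant:
  assumes \<delta>: "\<delta> > 0" "\<And>z. z \<in> ball w \<delta> \<Longrightarrow> poly q z \<noteq> 0 \<and> poly q (conj_map p q z) \<noteq> 0"
    and eq: "\<And>z. z \<in> ball w \<delta> \<Longrightarrow> conj_map p q (conj_map p q z) = z"
  shows False
proof -
  let ?r = "rational_fun p q" and ?g = "conj_map p q"
  define S where "S = {z. poly q z \<noteq> 0 \<and> poly q (?g z) \<noteq> 0}"
  have "- S \<subseteq> {z. poly q z = 0} \<union> (\<Union>y\<in>{y. poly q y = 0}. {z. poly (p - smult (cnj y) q) z = 0})"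
    by (auto simp: S_def conj_map_def rational_fun_def field_simps)
  moreover have "p - smult c q \<noteq> 0" for c
    using deg_p deg_q degree_smult_le[of c q] by (metis eq_iff_diff_eq_0 leD)
  then have "finite {z. poly (p - smult c q) z = 0}" for c by (rule poly_roots_finite)
  then have "finite ({z. poly q z = 0} \<union> (\<Union>y\<in>{y. poly q y = 0}. {z. poly (p - smult (cnj y) q) z = 0}))"
    using poly_roots_finite[OF q_nonzero] by blast
  ultimately have fin: "finite (- S)" by (rule finite_subset)
  have oS: "open S" using finite_imp_closed[OF fin] by (simp add: open_closed)
  have conS: "connected S"
    using connected_open_delete_finite[of "UNIV :: complex set" "- S"] fin connected_UNIV by (simp add: Compl_eq_Diff_UNIV[symmetric])
  have ball: "ball w \<delta> \<subseteq> S" using \<delta>(2) by (auto simp: S_def)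
  have hol: "(\<lambda>z. ?g (?g z) - z) holomorphic_on S"
  proof (intro holomorphic_intros)
    show "(\<lambda>z. ?g (?g z)) holomorphic_on S"
      unfolding holomorphic_on_open[OF oS] using conj_map2_has_deriv by (fastforce simp: S_def)
  qed
  have id: "?g (?g z) = z" if "z \<in> S" for z
  proof -
    have "?g (?g z) - z = 0"
    proof (rule analytic_continuation[OF hol oS conS, of "ball w \<delta>" w])
      show "w islimpt ball w \<delta>" using \<delta>(1) by (simp add: islimpt_ball)
    qed (use ball eq \<delta>(1) that in auto)
    then show ?thesis by simp
  qed
  have "finite (critical_values \<union> ?r ` (- S))" using fin finite_critical_values by blast
  \<comment> \<open>Avoiding the images of the exceptional points puts the whole fibre over
    \<open>b\<close> into \<open>S\<close>, where the identity is available.\<close>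
  then obtain b where b: "b \<notin> critical_values" "b \<notin> ?r ` (- S)"
    using infinite_UNIV_char_0 ex_new_if_finite by (metis UnI1 UnI2)
  have "card {z. poly q z \<noteq> 0 \<and> ?r z = b} = n"
    using b(1) by (intro fibre(2)) (auto simp: critical_values_def)
  moreover have "card {z. poly q z \<noteq> 0 \<and> ?r z = b} \<le> 1"
  proof (rule card_le_Suc0_iff_eq[THEN iffD2, unfolded One_nat_def[symmetric]])
    show "finite {z. poly q z \<noteq> 0 \<and> ?r z = b}"
      using b(1) by (intro fibre(1)) (auto simp: critical_values_def)
    show "\<forall>x\<in>{z. poly q z \<noteq> 0 \<and> ?r z = b}. \<forall>y\<in>{z. poly q z \<noteq> 0 \<and> ?r z = b}. x = y"
    proof (intro ballI)
      fix x y assume x: "x \<in> {z. poly q z \<noteq> 0 \<and> ?r z = b}" and y: "y \<in> {z. poly q z \<noteq> 0 \<and> ?r z = b}"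
      have "z \<in> S" if "?r z = b" for z using b(2) that by (metis ComplI imageI)
      then have "x \<in> S" "y \<in> S" using x y by auto
      then have "x = ?g (?g x)" "y = ?g (?g y)" by (simp_all only: id)
      moreover have "?g x = ?g y" using x y by (simp add: conj_map_def)
      ultimately show "x = y" by simp
    qed
  qed
  ultimately show False using n_ge_2 by simp
qed

text \<open>An attracting petal with an approximate Fatou coordinate. Since the second iterate has
  derivative 1 at \<open>w\<close> and is not the identity, it differs from the identity by a zero
  of finite order \<open>m = N + 1 \<ge> 2\<close>. In a coordinate proportional to the
  \<open>N\<close>-th power of \<open>1 / (z - w)\<close> it is nearly a translation by 1, so a far
  right half-plane is forward invariant.\<close>

lemma attracting_chart_of_parabolic:
  assumes w: "poly q w \<noteq> 0" "conj_map p q w = w" and d: "norm (deriv (rational_fun p q) w) = 1"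
  shows "\<exists>H \<sigma> F a b. attracting_chart p q w H \<sigma> F a b"
proof -
  let ?r = "rational_fun p q" and ?g = "conj_map p q"
  define Q where "Q z = ?g (?g z)" for z
  obtain d1 where d1: "d1 > 0" "\<And>z. dist z w < d1 \<Longrightarrow> poly q z \<noteq> 0"
    using nonpole_neighbourhood[OF w(1)] by blast
  obtain d2 where d2: "d2 > 0" "\<And>z. dist z w < d2 \<Longrightarrow> dist (?g z) w < d1"
  proof -
    have "\<exists>d>0. \<forall>z. dist z w < d \<longrightarrow> dist (?g z) (?g w) < d1"
      using continuous_conj_map[OF w(1), of p] d1(1) unfolding continuous_at_eps_delta by blast
    then show ?thesis using that unfolding w(2) by blast
  qed
  define \<delta> where "\<delta> = min d1 d2"
  have \<delta>: "\<delta> > 0" using d1 d2 by (simp add: \<delta>_def)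
  have nz: "poly q z \<noteq> 0" "poly q (?g z) \<noteq> 0" if "z \<in> ball w \<delta>" for z
    using d1(2) d2(2)[of z] that by (auto simp: \<delta>_def dist_commute)
  define f where "f z = Q z - z" for z
  have fd: "(f has_field_derivative cnj (deriv ?r (?g z)) * deriv ?r z - 1) (at z)" if "z \<in> ball w \<delta>" for z
    unfolding f_def Q_def
    by (rule DERIV_diff[OF conj_map2_has_deriv[OF nz(1)[OF that] nz(2)[OF that]] DERIV_ident])
  have holf: "f holomorphic_on ball w \<delta>"
    unfolding holomorphic_on_open[OF open_ball] using fd by blast
  have fw: "f w = 0" by (simp add: f_def Q_def w)
  have f'w: "(f has_field_derivative 0) (at w)"
  proof -
    have "cnj (deriv ?r w) * deriv ?r w = 1" using complex_norm_square[of "deriv ?r w"] d by (simp add: mult.commute)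
    then show ?thesis using fd[of w] \<delta> w(2) by simp
  qed
  have nonconst: "\<not> f constant_on ball w \<delta>"
  proof
    assume "f constant_on ball w \<delta>"
    then obtain y where "\<And>z. z \<in> ball w \<delta> \<Longrightarrow> f z = y" unfolding constant_on_def by blast
    then have "f z = 0" if "z \<in> ball w \<delta>" for z
      using fw \<delta> that by (metis centre_in_ball)
    then show False using second_iterate_nonconstant[OF \<delta>, of w] nz by (auto simp: f_def Q_def)
  qed
  obtain h r m where m: "0 < m" and r: "0 < r" "ball w r \<subseteq> ball w \<delta>" and h: "h holomorphic_on ball w r"
    and fh: "\<And>z. z \<in> ball w r \<Longrightarrow> f z = (z - w) ^ m * h z" "\<And>z. z \<in> ball w r \<Longrightarrow> h z \<noteq> 0"
    by (rule holomorphic_factor_zero_nonconstant[OF holf open_ball connected_ball _ fw nonconst])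
      (use \<delta> in auto)
  have hw: "h w \<noteq> 0" using fh r by simp
  have hc: "isCont h w"
    using holomorphic_on_imp_continuous_on[OF h] r(1) by (simp add: continuous_on_eq_continuous_at)
  have "m \<noteq> 1"
  proof
    assume m1: "m = 1"
    have "((\<lambda>z. (f z - f w) / (z - w)) \<longlongrightarrow> 0) (at w)" using f'w by (simp add: has_field_derivative_iff)
    then have "((\<lambda>z. (f z - f w) / (z - w)) \<longlongrightarrow> 0) (at w)" by simp
    moreover have "\<forall>\<^sub>F z in at w. (f z - f w) / (z - w) = h z"
      using eventually_at_in_open[of "ball w r" w] r(1)
      by (auto elim!: eventually_mono simp: fh(1) m1 fw)
    ultimately have "(h \<longlongrightarrow> 0) (at w)" by (rule Lim_transform_eventually)
    then have "0 = h w" using hc unfolding isCont_def by (rule LIM_unique)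
    then show False using hw by simp
  qed
  then obtain N where N: "m = Suc N" "N > 0" using m that[of "m - 1"] by simp
  \<comment> \<open>With \<open>v = z - w\<close> the coordinate is
    \<open>u = c ^ N / v ^ N\<close>. Adding \<open>v ^ (N + 1) * h z\<close> to \<open>z\<close>
    changes \<open>u\<close> by about \<open>- N * c ^ N * h w\<close>; the choice of
    \<open>c\<close> makes this 1.\<close>
  define c where "c = exp (Ln (- 1 / (of_nat N * h w)) / of_nat N)"
  have cN: "c ^ N = - 1 / (of_nat N * h w)"
    unfolding c_def exp_of_nat_mult[symmetric] using N hw by simp
  define v where "v u = c * exp (- Ln u / of_nat N)" for u
  define \<sigma> where "\<sigma> u = w + v u" for u
  define s where "s u = c ^ N * h (\<sigma> u) / u" for u
  define F where "F u = u / (1 + s u) ^ N" for u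
  have vN: "v u ^ N = c ^ N / u" if "u \<noteq> 0" for u
    unfolding v_def power_mult_distrib exp_of_nat_mult[symmetric] using N that by (simp add: exp_minus field_simps)
  have vlim: "(v \<longlongrightarrow> 0) at_infinity"
  proof -
    have "((\<lambda>u::complex. norm u powr (- 1 / of_nat N)) \<longlongrightarrow> 0) at_infinity"
      using N by (intro tendsto_neg_powr filterlim_at_infinity_imp_norm_at_top filterlim_ident) auto
    then have "((\<lambda>u::complex. norm c * norm u powr (- 1 / of_nat N)) \<longlongrightarrow> 0) at_infinity"
      by (rule tendsto_mult_right_zero)
    moreover have "\<forall>\<^sub>F u in at_infinity. norm (v u) \<le> norm c * norm u powr (- 1 / of_nat N)"
    proof (rule eventually_mono[OF eventually_not_equal_at_infinity[of 0]])
      fix u :: complex assume "u \<noteq> 0"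
      then show "norm (v u) \<le> norm c * norm u powr (- 1 / of_nat N)"
        by (simp add: v_def norm_mult norm_exp_eq_Re powr_def)
    qed
    ultimately show ?thesis by (rule Lim_null_comparison[rotated])
  qed
  have \<sigma>lim: "(\<sigma> \<longlongrightarrow> w) at_infinity"
    unfolding \<sigma>_def using tendsto_add[OF tendsto_const vlim, of w] by simp
  have hlim: "((\<lambda>u. h (\<sigma> u)) \<longlongrightarrow> h w) at_infinity" by (rule isCont_tendsto_compose[OF hc \<sigma>lim])
  have slim: "(s \<longlongrightarrow> 0) at_infinity"
    using tendsto_mult[OF tendsto_mult[OF tendsto_const hlim, of "c ^ N"] tendsto_inverse_0]
    by (simp add: s_def[abs_def] divide_inverse)
  \<comment> \<open>The increment \<open>F u - u\<close> is \<open>u\<close> times the change of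
    \<open>1 / (1 + s) ^ N\<close> from \<open>s = 0\<close>. Its Caratheodory slope
    \<open>\<psi>\<close> has value \<open>- N\<close> there, which yields the limit 1.\<close>
  have "((\<lambda>s. 1 / (1 + s) ^ N) has_field_derivative - of_nat N) (at (0::complex))"
    using N by (auto intro!: derivative_eq_intros)
  then obtain \<psi> :: "complex \<Rightarrow> complex" where \<psi>': "\<forall>s. 1 / (1 + s) ^ N - 1 / (1 + 0) ^ N = \<psi> s * (s - 0)"
    and \<psi>: "isCont \<psi> 0" "\<psi> 0 = - of_nat N"
    unfolding CARAT_DERIV by blast
  have \<psi>s: "1 / (1 + s) ^ N - 1 = \<psi> s * s" for s using \<psi>'[rule_format, of s] by simp
  have "((\<lambda>u. c ^ N * h (\<sigma> u) * \<psi> (s u)) \<longlongrightarrow> c ^ N * h w * \<psi> 0) at_infinity"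
    by (intro tendsto_intros hlim isCont_tendsto_compose[OF \<psi>(1) slim])
  moreover have "c ^ N * h w * \<psi> 0 = 1" using cN hw N \<psi>(2) by simp
  moreover have "\<forall>\<^sub>F u in at_infinity. c ^ N * h (\<sigma> u) * \<psi> (s u) = F u - u"
  proof (rule eventually_mono[OF eventually_not_equal_at_infinity[of 0]])
    fix u :: complex assume u: "u \<noteq> 0"
    have "F u - u = u * (1 / (1 + s u) ^ N - 1)" by (simp add: F_def algebra_simps)
    also have "\<dots> = c ^ N * h (\<sigma> u) * \<psi> (s u)" using u unfolding \<psi>s by (simp add: s_def)
    finally show "c ^ N * h (\<sigma> u) * \<psi> (s u) = F u - u" by simp
  qed
  ultimately have "((\<lambda>u. F u - u) \<longlongrightarrow> 1) at_infinity"
    using Lim_transform_eventually by simp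
  then have e1: "\<forall>\<^sub>F u in at_infinity. dist (F u - u) 1 < 1 / 2" by (rule tendstoD) simp
  have e2: "\<forall>\<^sub>F u in at_infinity. dist (\<sigma> u) w < r" using \<sigma>lim r(1) by (rule tendstoD)
  have "((\<lambda>u. Ln (1 + s u)) \<longlongrightarrow> Ln (1 + 0)) at_infinity"
    by (intro tendsto_intros slim) auto
  \<comment> \<open>This keeps \<open>N * Ln (1 + s u)\<close> below 1 in modulus. On the half-plane
    the imaginary part of \<open>Ln u\<close> is below \<open>pi / 2\<close> in modulus, so
    \<open>Ln (F u)\<close> can be computed without a branch jump.\<close>
  then have e3: "\<forall>\<^sub>F u in at_infinity. dist (Ln (1 + s u)) 0 < 1 / of_nat N"
    using N by (intro tendstoD) auto
  have e4: "\<forall>\<^sub>F u in at_infinity. dist (s u) 0 < 1" by (rule tendstoD[OF slim]) simp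
  from e1 e2 e3 e4 have "\<forall>\<^sub>F u in at_infinity. dist (F u - u) 1 < 1 / 2 \<and> dist (\<sigma> u) w < r \<and>
      dist (Ln (1 + s u)) 0 < 1 / of_nat N \<and> dist (s u) 0 < 1"
    by eventually_elim auto
  then obtain B where B: "\<And>u. norm u \<ge> B \<Longrightarrow> dist (F u - u) 1 < 1 / 2 \<and> dist (\<sigma> u) w < r \<and>
      dist (Ln (1 + s u)) 0 < 1 / of_nat N \<and> dist (s u) 0 < 1"
    unfolding eventually_at_infinity by blast
  define R where "R = max B 1"
  define H where "H = {u. Re u > R}"
  have R: "dist (F u - u) 1 < 1 / 2" "dist (\<sigma> u) w < r" "norm (Ln (1 + s u)) < 1 / of_nat N" "norm (s u) < 1"
    "Re u > 1" if "u \<in> H" for u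
    using B[of u] that complex_Re_le_cmod[of u] by (auto simp: H_def R_def)
  have \<sigma>ball: "\<sigma> u \<in> ball w r" if "u \<in> H" for u using R(2)[OF that] by (simp add: dist_commute)
  have snz: "1 + s u \<noteq> 0" if "u \<in> H" for u
    using R(4)[OF that] by (metis add_eq_0_iff norm_minus_cancel norm_one less_irrefl)
  have ReF: "Re u + 1/2 < Re (F u)" if "u \<in> H" for u
  proof -
    have "\<bar>Re (F u - u - 1)\<bar> < 1/2" using R(1)[OF that] abs_Re_le_cmod[of "F u - u - 1"] by (simp add: dist_norm)
    then show ?thesis unfolding minus_complex.sel one_complex.sel by linarith
  qed
  have FH: "F u \<in> H" if "u \<in> H" for u using ReF[OF that] that by (simp add: H_def)
  have semiconj: "Q (\<sigma> u) = \<sigma> (F u)" if u: "u \<in> H" for u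
  proof -
    have u0: "u \<noteq> 0" "Re u > 0" using R(5)[OF u] by auto
    have "Ln (F u) = Ln u - of_nat N * Ln (1 + s u)"
    proof (rule Ln_unique)
      show "exp (Ln u - of_nat N * Ln (1 + s u)) = F u"
        using u0 snz[OF u] by (simp add: exp_diff exp_of_nat_mult F_def)
      have "norm (of_nat N * Ln (1 + s u)) < 1"
        using R(3)[OF u] N by (simp add: norm_mult field_simps)
      then have "\<bar>Im (of_nat N * Ln (1 + s u))\<bar> < 1" using abs_Im_le_cmod order_le_less_trans by blast
      moreover have "\<bar>Im (Ln u)\<bar> < pi / 2" using Re_Ln_pos_lt[of u] u0 by simp
      ultimately show "- pi < Im (Ln u - of_nat N * Ln (1 + s u))" "Im (Ln u - of_nat N * Ln (1 + s u)) \<le> pi"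
        using pi_gt3 by auto
    qed
    then have LnF: "- Ln (F u) / of_nat N = - Ln u / of_nat N + Ln (1 + s u)" using N by (simp add: field_simps)
    have "v (F u) = v u * (1 + s u)" unfolding v_def LnF exp_add using snz[OF u] by simp
    also have "\<dots> = v u + v u ^ m * h (\<sigma> u)" using u0 by (simp add: s_def N vN field_simps)
    also have "\<dots> = v u + f (\<sigma> u)" using fh(1)[OF \<sigma>ball[OF u]] by (simp add: \<sigma>_def)
    finally show ?thesis by (simp add: f_def \<sigma>_def)
  qed
  have Fk: "(F ^^ k) u \<in> H \<and> Re ((F ^^ k) u) \<ge> Re u + k / 2" if "u \<in> H" for u k
  proof (induction k)
    case (Suc k)
    then show ?case using FH[of "(F ^^ k) u"] ReF[of "(F ^^ k) u"] by (simp add: field_simps)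
  qed (use that in auto)
  have semik: "(?g ^^ (2 * k)) (\<sigma> u) = \<sigma> ((F ^^ k) u)" if "u \<in> H" for u k
  proof (induction k)
    case (Suc k)
    then show ?case using semiconj[of "(F ^^ k) u"] Fk[OF that, of k] by (simp add: Q_def)
  qed auto
  have oH: "open H" unfolding H_def by (rule open_halfspace_Re_gt)
  have holv: "\<sigma> holomorphic_on H"
    unfolding \<sigma>_def v_def
    by (intro holomorphic_intros) (use R(5) N in \<open>auto simp: complex_nonpos_Reals_iff dest!: R(5)\<close>)
  have sc: "continuous_on H s"
  proof -
    have "continuous_on H (\<lambda>u. h (\<sigma> u))"
      by (rule continuous_on_compose2[OF holomorphic_on_imp_continuous_on[OF h] holomorphic_on_imp_continuous_on[OF holv]])
        (use \<sigma>ball in blast)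
    then show ?thesis unfolding s_def
      by (intro continuous_intros) (use R(5) in force)+
  qed
  have basin: "\<sigma> u \<in> basin p q w" if u: "u \<in> H" for u
  proof -
    have inb: "\<sigma> ((F ^^ k) u) \<in> ball w \<delta>" for k using \<sigma>ball[of "(F ^^ k) u"] Fk[OF u] r(2) by blast
    have "filterlim (\<lambda>k. Re u + real k / 2) at_top sequentially"
      by (intro filterlim_tendsto_add_at_top[OF tendsto_const] filterlim_at_top_mult_tendsto_pos[OF tendsto_const _ filterlim_real_sequentially, of "1/2", simplified])
    then have "filterlim (\<lambda>k. norm ((F ^^ k) u)) at_top sequentially"
      by (rule filterlim_at_top_mono)
        (auto intro!: always_eventually order_trans[OF conjunct2[OF Fk[OF u]] complex_Re_le_cmod])
    then have "filterlim (\<lambda>k. (F ^^ k) u) at_infinity sequentially"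
      by (rule filterlim_norm_at_top_imp_at_infinity)
    then have even: "(\<lambda>k. \<sigma> ((F ^^ k) u)) \<longlonglongrightarrow> w" by (rule filterlim_compose[OF \<sigma>lim])
    \<comment> \<open>The chart sees only even iterates; the odd ones follow by continuity of
      \<open>?g\<close> at its fixed point \<open>w\<close>.\<close>
    have odd: "(\<lambda>k. ?g (\<sigma> ((F ^^ k) u))) \<longlonglongrightarrow> w"
      using isCont_tendsto_compose[OF continuous_conj_map[OF w(1), of p] even] w(2) by simp
    have "(\<lambda>i. (?g ^^ i) (\<sigma> u)) \<longlonglongrightarrow> w"
      by (rule LIMSEQ_even_odd) (use even odd semik[OF u] in auto)
    moreover have "poly q ((?g ^^ i) (\<sigma> u)) \<noteq> 0" for i
    proof (cases "even i")
      case True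
      then obtain k where "i = 2 * k" by (elim evenE)
      then show ?thesis using nz(1)[OF inb] semik[OF u] by simp
    next
      case False
      then obtain k where "i = 2 * k + 1" by (elim oddE)
      then show ?thesis using nz(2)[OF inb] semik[OF u] by simp
    qed
    ultimately show ?thesis by (simp add: basin_def)
  qed
  define a where "a = complex_of_real (R + 1)"
  have aH: "a \<in> H" by (simp add: a_def H_def)
  \<comment> \<open>Consecutive points of the orbit are less than \<open>3 / 2\<close> apart, while
    the \<open>k\<close>-th one lies deeper than \<open>k / 2\<close> inside \<open>H\<close>. Hence
    the radius \<open>k / 2\<close> and the requirement \<open>k > 3 / e\<close> below.\<close>
  have "attracting_chart p q w H \<sigma> F a (F a)"
    unfolding attracting_chart_def
  proof (intro conjI ballI allI impI)
    show "open H" by (rule oH)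
    show "convex H" unfolding H_def by (rule convex_halfspace_Re_gt)
    show "\<sigma> holomorphic_on H" by (rule holv)
    show "\<sigma> ` H \<subseteq> basin p q w" using basin by blast
    show "continuous_on H F" unfolding F_def by (intro continuous_intros sc) (use snz in auto)
    show "F ` H \<subseteq> H" using FH by blast
    show "?g (?g (\<sigma> u)) = \<sigma> (F u)" if "u \<in> H" for u using semiconj[OF that] by (simp add: Q_def)
    show "a \<in> H" "F a \<in> H" using aH FH by auto
    show "\<sigma> a \<noteq> \<sigma> (F a)"
    proof
      assume "\<sigma> a = \<sigma> (F a)"
      then have "v a ^ N = v (F a) ^ N" by (simp add: \<sigma>_def)
      moreover have "a \<noteq> 0" "F a \<noteq> 0" using R(5)[OF aH] R(5)[OF FH[OF aH]] by auto
      moreover have "c ^ N \<noteq> 0" using cN hw N by simp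
      ultimately have "F a = a" by (auto simp: vN)
      then show False using ReF[OF aH] by simp
    qed
    fix e :: real assume e: "e > 0"
    obtain k :: nat where k: "real k > 3 / e" using reals_Archimedean2 by blast
    have k0: "real k > 0" using k divide_pos_pos[of 3 e] e by linarith
    show "\<exists>k \<rho>. \<rho> > 0 \<and> ball ((F ^^ k) a) \<rho> \<subseteq> H \<and> dist ((F ^^ k) a) ((F ^^ k) (F a)) < e * \<rho>"
    proof (intro exI conjI)
      show "real k / 2 > 0" using k0 by simp
      show "ball ((F ^^ k) a) (real k / 2) \<subseteq> H"
      proof
        fix x assume "x \<in> ball ((F ^^ k) a) (real k / 2)"
        then have "norm ((F ^^ k) a - x) < real k / 2" by (simp add: dist_norm)
        moreover have "Re ((F ^^ k) a) - Re x \<le> norm ((F ^^ k) a - x)"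
          using complex_Re_le_cmod[of "(F ^^ k) a - x"] by simp
        moreover have "Re a = R + 1" by (simp add: a_def)
        ultimately have "Re x > R" using conjunct2[OF Fk[OF aH, of k]] by linarith
        then show "x \<in> H" by (simp add: H_def)
      qed
      let ?u = "(F ^^ k) a"
      have "(F ^^ k) (F a) = F ?u" by (simp add: funpow_swap1)
      moreover have "norm (F ?u - ?u) \<le> norm (F ?u - ?u - 1) + 1"
        using norm_triangle_ineq[of "F ?u - ?u - 1" 1] by simp
      moreover have "norm (F ?u - ?u - 1) < 1 / 2" using R(1)[of ?u] Fk[OF aH, of k] by (simp add: dist_norm)
      moreover have "e * (real k / 2) > 3 / 2" using k e by (simp add: field_simps)
      ultimately show "dist ((F ^^ k) a) ((F ^^ k) (F a)) < e * (real k / 2)"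
        by (simp add: dist_norm norm_minus_commute)
    qed
  qed
  then show ?thesis by blast
qed

lemma attracting_chart_exists:
  assumes "w \<in> nonrepelling p q"
  obtains H \<sigma> F a b where "attracting_chart p q w H \<sigma> F a b"
  using assms attracting_chart_of_attracting[of q w p] attracting_chart_of_parabolic[of w]
  unfolding nonrepelling_def by (force simp: le_less)

text \<open>By the open mapping theorem the image of a chart is open.\<close>

lemma basin_contains_open:
  assumes "w \<in> nonrepelling p q"
  obtains W where "open W" "W \<noteq> {}" "W \<subseteq> basin p q w"
proof -
  obtain H \<sigma> F a b where c: "attracting_chart p q w H \<sigma> F a b" using attracting_chart_exists[OF assms] .
  have "open (\<sigma> ` H)"
  proof (rule open_mapping_thm)
    show "\<not> \<sigma> constant_on H" using c unfolding attracting_chart_def constant_on_def by metis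
  qed (use c in \<open>auto simp: attracting_chart_def intro: convex_connected\<close>)
  then show ?thesis using that[of "\<sigma> ` H"] c by (auto simp: attracting_chart_def)
qed

text \<open>The second point \<open>w'\<close> provides, through its basin, the open set that the
  inverse branches at \<open>w\<close> have to omit.\<close>

theorem nonrepelling_attracts_critical:
  assumes w: "w \<in> nonrepelling p q" and w': "w' \<in> nonrepelling p q" and "w \<noteq> w'"
  shows "\<exists>c\<in>basin p q w. poly (wronskian p q) c = 0"
proof -
  obtain H \<sigma> F a b where c: "attracting_chart p q w H \<sigma> F a b" using attracting_chart_exists[OF w] .
  obtain W where W: "open W" "W \<noteq> {}" "W \<subseteq> basin p q w'" using basin_contains_open[OF w'] .
  show ?thesis
  proof (rule attracting_chart_imp_critical[of H \<sigma> w F a b W])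
    show "W \<inter> basin p q w = {}" using W(3) basin_disjoint \<open>w \<noteq> w'\<close> by blast
  qed (use c W in \<open>auto simp: attracting_chart_def\<close>)
qed

end

subsection \<open>Moebius change of coordinate and the bound for non-repelling zeros\<close>

text \<open>For \<open>degree s \<le> n\<close> this is
  \<open>\<zeta> ^ n * poly s (a + 1 / \<zeta>)\<close> as a polynomial: the Taylor coefficients of
  \<open>s\<close> at \<open>a\<close> in reverse order. A fixed \<open>n\<close>, rather than the
  degree of \<open>s\<close>, lets the powers of \<open>\<zeta>\<close> cancel between numerator and
  denominator.\<close>

definition invert_at :: "nat \<Rightarrow> complex \<Rightarrow> complex poly \<Rightarrow> complex poly" where
  "invert_at n a s = (\<Sum>i\<le>n. monom (coeff (pcompose s [:a, 1:]) i) (n - i))"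

lemma coeff_invert_at: "k \<le> n \<Longrightarrow> coeff (invert_at n a s) k = coeff (pcompose s [:a, 1:]) (n - k)"
proof -
  assume k: "k \<le> n"
  have "coeff (invert_at n a s) k = (\<Sum>i\<le>n. if i = n - k then coeff (pcompose s [:a, 1:]) i else 0)"
    unfolding invert_at_def coeff_sum using k by (intro sum.cong) auto
  then show ?thesis using k by simp
qed

lemma degree_invert_at: "degree (invert_at n a s) \<le> n"
  unfolding invert_at_def by (intro degree_sum_le) (auto intro: order_trans[OF degree_monom_le])

lemma poly_invert_at:
  assumes "degree s \<le> n" "\<zeta> \<noteq> 0"
  shows "poly (invert_at n a s) \<zeta> = \<zeta> ^ n * poly s (a + 1 / \<zeta>)"
proof -
  let ?t = "pcompose s [:a, 1:]"
  have "degree ?t \<le> n" using assms(1) by (simp add: degree_pcompose)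
  then have "poly ?t (1 / \<zeta>) = (\<Sum>i\<le>n. coeff ?t i * (1 / \<zeta>) ^ i)"
    unfolding poly_altdef by (intro sum.mono_neutral_left) (auto simp: coeff_eq_0)
  then have "\<zeta> ^ n * poly s (a + 1 / \<zeta>) = (\<Sum>i\<le>n. \<zeta> ^ n * (coeff ?t i * (1 / \<zeta>) ^ i))"
    by (simp add: poly_pcompose sum_distrib_left)
  also have "\<dots> = (\<Sum>i\<le>n. coeff ?t i * \<zeta> ^ (n - i))"
    using assms(2) by (intro sum.cong) (auto simp: power_diff power_divide)
  also have "\<dots> = poly (invert_at n a s) \<zeta>"
    by (simp add: invert_at_def poly_sum poly_monom)
  finally show ?thesis by simp
qed

lemma pderiv_invert_at:
  assumes "degree s \<le> n" "\<zeta> \<noteq> 0"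
  shows "\<zeta>\<^sup>2 * poly (pderiv (invert_at n a s)) \<zeta>
       = of_nat n * \<zeta> ^ Suc n * poly s (a + 1 / \<zeta>) - \<zeta> ^ n * poly (pderiv s) (a + 1 / \<zeta>)"
proof -
  have "((\<lambda>\<zeta>. \<zeta> ^ n * poly s (a + 1 / \<zeta>)) has_field_derivative
      (of_nat n * \<zeta> ^ (n - 1) * poly s (a + 1 / \<zeta>) + \<zeta> ^ n * (poly (pderiv s) (a + 1 / \<zeta>) * (- 1 / \<zeta>\<^sup>2)))) (at \<zeta>)"
    by (rule derivative_eq_intros refl DERIV_chain'[OF _ poly_DERIV] assms(2))+
      (use assms(2) in \<open>simp add: power2_eq_square field_simps\<close>)
  moreover have ev: "\<forall>\<^sub>F x in nhds \<zeta>. poly (invert_at n a s) x = x ^ n * poly s (a + 1 / x)"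
    using t1_space_nhds[OF assms(2)] by (rule eventually_mono) (rule poly_invert_at[OF assms(1)])
  ultimately have "(poly (invert_at n a s) has_field_derivative
      (of_nat n * \<zeta> ^ (n - 1) * poly s (a + 1 / \<zeta>) + \<zeta> ^ n * (poly (pderiv s) (a + 1 / \<zeta>) * (- 1 / \<zeta>\<^sup>2)))) (at \<zeta>)"
    by (subst DERIV_cong_ev[OF refl ev refl])
  from DERIV_unique[OF poly_DERIV this] have P': "poly (pderiv (invert_at n a s)) \<zeta> =
      of_nat n * \<zeta> ^ (n - 1) * poly s (a + 1 / \<zeta>) + \<zeta> ^ n * (poly (pderiv s) (a + 1 / \<zeta>) * (- 1 / \<zeta>\<^sup>2))" .
  have pow: "of_nat n * \<zeta> ^ (n - 1) * \<zeta>\<^sup>2 = of_nat n * \<zeta> ^ Suc n"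
    by (cases n) (auto simp: power2_eq_square)
  have alg: "\<zeta>\<^sup>2 * (A * S + Z * (D * (- 1 / \<zeta>\<^sup>2))) = A * \<zeta>\<^sup>2 * S - Z * D" for A S Z D
    using assms(2) by (simp add: field_simps)
  show ?thesis unfolding P' alg pow ..
qed

text \<open>The Moebius change of coordinate \<open>\<zeta> = 1 / (z - a)\<close> at a fixed point \<open>a\<close> of \<open>conj_map p q\<close>:
  it sends \<open>a\<close> to infinity and conjugates \<open>conj_map p q\<close> to \<open>conj_map (num_at \<dots>) (den_at \<dots>)\<close>.\<close>

definition num_at :: "nat \<Rightarrow> complex \<Rightarrow> complex poly \<Rightarrow> complex poly" where
  "num_at n a q = invert_at n a q"

definition den_at :: "nat \<Rightarrow> complex \<Rightarrow> complex poly \<Rightarrow> complex poly \<Rightarrow> complex poly" where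
  "den_at n a p q = invert_at n a (p - smult (cnj a) q)"

locale rational_pair =
  fixes p q :: "complex poly" and n :: nat
  assumes max_deg: "max (degree p) (degree q) = n" and n_ge_2': "n \<ge> 2"
    and no_common_root': "\<And>z. poly p z \<noteq> 0 \<or> poly q z \<noteq> 0"
begin

lemma deg_le: "degree p \<le> n" "degree q \<le> n" "degree (p - smult c q) \<le> n"
  using max_deg degree_smult_le[of c q] by (auto intro!: degree_diff_le)

lemma poly_num_at: "\<zeta> \<noteq> 0 \<Longrightarrow> poly (num_at n a q) \<zeta> = \<zeta> ^ n * poly q (a + 1 / \<zeta>)"
  and poly_den_at: "\<zeta> \<noteq> 0 \<Longrightarrow> poly (den_at n a p q) \<zeta> = \<zeta> ^ n * (poly p (a + 1 / \<zeta>) - cnj a * poly q (a + 1 / \<zeta>))"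
  unfolding num_at_def den_at_def using deg_le by (simp_all add: poly_invert_at)

lemma conj_map_num_den:
  assumes "poly q z \<noteq> 0" "z \<noteq> a"
  shows "conj_map (num_at n a q) (den_at n a p q) (1 / (z - a)) = 1 / (conj_map p q z - a)"
    and "poly (den_at n a p q) (1 / (z - a)) \<noteq> 0 \<longleftrightarrow> conj_map p q z \<noteq> a"
proof -
  let ?\<zeta> = "1 / (z - a)"
  have \<zeta>: "?\<zeta> \<noteq> 0" "a + 1 / ?\<zeta> = z" using assms(2) by auto
  have den: "poly (den_at n a p q) ?\<zeta> = ?\<zeta> ^ n * (poly p z - cnj a * poly q z)"
    and num: "poly (num_at n a q) ?\<zeta> = ?\<zeta> ^ n * poly q z"
    using poly_den_at[OF \<zeta>(1), of a] poly_num_at[OF \<zeta>(1), of a] \<zeta>(2) by simp_all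
  \<comment> \<open>This is where \<open>cnj a\<close> in the denominator comes from:
    \<open>conj_map p q z - a\<close> is the conjugate of
    \<open>rational_fun p q z - cnj a\<close>.\<close>
  have *: "poly p z - cnj a * poly q z = poly q z * (rational_fun p q z - cnj a)"
    using assms(1) by (simp add: rational_fun_def field_simps)
  have "rational_fun (num_at n a q) (den_at n a p q) ?\<zeta> = 1 / (rational_fun p q z - cnj a)"
    unfolding rational_fun_def[of "num_at n a q"] den num * using \<zeta>(1) assms(1) by simp
  then show "conj_map (num_at n a q) (den_at n a p q) ?\<zeta> = 1 / (conj_map p q z - a)"
    by (simp add: conj_map_def)
  show "poly (den_at n a p q) ?\<zeta> \<noteq> 0 \<longleftrightarrow> conj_map p q z \<noteq> a"
    unfolding den * using \<zeta>(1) assms by (auto simp: conj_map_eq_iff)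
qed

text \<open>The terms with the factor \<open>n\<close> are proportional to the functions themselves
  and cancel. So nonzero critical points \<open>\<zeta>\<close> correspond to critical points
  \<open>a + 1 / \<zeta>\<close>.\<close>

lemma wronskian_num_den:
  assumes \<zeta>: "\<zeta> \<noteq> 0"
  shows "\<zeta>\<^sup>2 * poly (wronskian (num_at n a q) (den_at n a p q)) \<zeta> = \<zeta> ^ (2 * n) * poly (wronskian p q) (a + 1 / \<zeta>)"
proof -
  let ?P = "num_at n a q" and ?Q = "den_at n a p q" and ?z = "a + 1 / \<zeta>"
  have "\<zeta>\<^sup>2 * poly (wronskian ?P ?Q) \<zeta> = (\<zeta>\<^sup>2 * poly (pderiv ?P) \<zeta>) * poly ?Q \<zeta> - poly ?P \<zeta> * (\<zeta>\<^sup>2 * poly (pderiv ?Q) \<zeta>)"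
    by (simp add: wronskian_def algebra_simps)
  also have "\<zeta>\<^sup>2 * poly (pderiv ?P) \<zeta> = of_nat n * \<zeta> ^ Suc n * poly q ?z - \<zeta> ^ n * poly (pderiv q) ?z"
    unfolding num_at_def by (rule pderiv_invert_at[OF deg_le(2) \<zeta>])
  also have "\<zeta>\<^sup>2 * poly (pderiv ?Q) \<zeta> = of_nat n * \<zeta> ^ Suc n * (poly p ?z - cnj a * poly q ?z)
      - \<zeta> ^ n * (poly (pderiv p) ?z - cnj a * poly (pderiv q) ?z)"
    unfolding den_at_def by (subst pderiv_invert_at[OF deg_le(3) \<zeta>]) (simp add: pderiv_diff pderiv_smult)
  finally have W: "\<zeta>\<^sup>2 * poly (wronskian ?P ?Q) \<zeta>
      = (of_nat n * \<zeta> ^ Suc n * poly q ?z - \<zeta> ^ n * poly (pderiv q) ?z) * poly ?Q \<zeta>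
      - poly ?P \<zeta> * (of_nat n * \<zeta> ^ Suc n * (poly p ?z - cnj a * poly q ?z)
      - \<zeta> ^ n * (poly (pderiv p) ?z - cnj a * poly (pderiv q) ?z))" .
  have "\<zeta> ^ (2 * n) = \<zeta> ^ n * \<zeta> ^ n" by (simp add: mult_2 power_add)
  then show ?thesis
    unfolding W poly_num_at[OF \<zeta>] poly_den_at[OF \<zeta>] wronskian_def[of p q] by (simp add: algebra_simps)
qed

text \<open>The coefficients of degree \<open>n\<close> are \<open>poly q a\<close>, which is
  nonzero, and \<open>poly p a - cnj a * poly q a\<close>, which vanishes exactly because
  \<open>a\<close> is fixed. A common root at the origin would make the coefficients of degree
  \<open>n\<close> of \<open>p\<close> and \<open>q\<close> both vanish.\<close>

lemma fixed_infinity_num_den: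
  assumes a: "poly q a \<noteq> 0" "conj_map p q a = a"
  shows "fixed_infinity (num_at n a q) (den_at n a p q) n"
proof
  let ?P = "num_at n a q" and ?Q = "den_at n a p q"
  have pa: "poly p a = cnj a * poly q a"
    using a by (simp add: conj_map_eq_iff rational_fun_def field_simps)
  have "coeff ?P n = poly q a" by (simp add: num_at_def coeff_invert_at poly_0_coeff_0[symmetric] poly_pcompose)
  then show "degree ?P = n" using a(1) degree_invert_at[of n a q]
    by (metis le_antisym le_degree num_at_def)
  have "coeff ?Q n = 0" by (simp add: den_at_def coeff_invert_at poly_0_coeff_0[symmetric] poly_pcompose pa)
  then show "degree ?Q < n" using degree_invert_at[of n a "p - smult (cnj a) q"] n_ge_2'
    by (metis den_at_def eq_zero_or_degree_less less_le_trans order_le_less pos2 degree_0)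
  show "n \<ge> 2" by (rule n_ge_2')
  show "poly ?P \<zeta> \<noteq> 0 \<or> poly ?Q \<zeta> \<noteq> 0" for \<zeta>
  proof (cases "\<zeta> = 0")
    case False
    then show ?thesis using no_common_root'[of "a + 1 / \<zeta>"] by (auto simp: poly_num_at poly_den_at)
  next
    case True
    have top: "coeff (pcompose s [:a, 1:]) n = coeff s n" if "degree s \<le> n" for s :: "complex poly"
    proof (cases "degree s = n")
      case True
      then show ?thesis using lead_coeff_comp[of "[:a, 1:]" s] by (simp add: degree_pcompose)
    next
      case False
      then show ?thesis using that by (simp add: coeff_eq_0 degree_pcompose)
    qed
    have "coeff p n \<noteq> 0 \<or> coeff q n \<noteq> 0" using max_deg n_ge_2'
      by (metis leading_coeff_0_iff max_def degree_0 not_numeral_le_zero)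
    then show ?thesis using True deg_le
      by (auto simp: num_at_def den_at_def poly_0_coeff_0 coeff_invert_at top)
  qed
qed

text \<open>The modulus of a multiplier is invariant under conjugation; here this comes from the
  Wronskian formula and \<open>poly p b = cnj b * poly q b\<close>.\<close>

lemma nonrepelling_num_den:
  assumes b: "b \<in> nonrepelling p q" "b \<noteq> a"
  shows "1 / (b - a) \<in> nonrepelling (num_at n a q) (den_at n a p q)"
proof -
  let ?P = "num_at n a q" and ?Q = "den_at n a p q" and ?\<zeta> = "1 / (b - a)"
  have qb: "poly q b \<noteq> 0" and gb: "conj_map p q b = b" and db: "norm (deriv (rational_fun p q) b) \<le> 1"
    using b(1) by (auto simp: nonrepelling_def)
  have \<zeta>: "?\<zeta> \<noteq> 0" "a + 1 / ?\<zeta> = b" using b(2) by auto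
  have Q0: "poly ?Q ?\<zeta> \<noteq> 0" and fixed: "conj_map ?P ?Q ?\<zeta> = ?\<zeta>"
    using conj_map_num_den[OF qb b(2)] gb b(2) by auto
  have pb: "poly p b = cnj b * poly q b" using gb qb by (simp add: conj_map_eq_iff rational_fun_def field_simps)
  have "poly ?Q ?\<zeta> = ?\<zeta> ^ n * (poly q b * cnj (b - a))"
    using poly_den_at[OF \<zeta>(1), of a] unfolding \<zeta>(2) pb by (simp add: algebra_simps)
  then have nQ: "norm (poly ?Q ?\<zeta>) = norm ?\<zeta> ^ n * (norm (poly q b) * norm (b - a))"
    by (simp add: norm_mult norm_power del: complex_cnj_diff)
  have alg: "(Z ^ n * (x * y))\<^sup>2 * Z\<^sup>2 = Z ^ (2 * n) * x\<^sup>2 * (Z * y)\<^sup>2" for x y Z :: real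
    by (simp add: power_mult_distrib power_mult[symmetric] mult_ac)
  have "norm ?\<zeta> * norm (b - a) = 1" using b(2) by (simp add: norm_divide)
  then have "norm ((poly ?Q ?\<zeta>)\<^sup>2) * (norm ?\<zeta>)\<^sup>2 = norm ?\<zeta> ^ (2 * n) * (norm (poly q b))\<^sup>2"
    unfolding norm_power nQ alg by simp
  moreover have "(norm ?\<zeta>)\<^sup>2 * norm (poly (wronskian ?P ?Q) ?\<zeta>) = norm ?\<zeta> ^ (2 * n) * norm (poly (wronskian p q) b)"
    using wronskian_num_den[OF \<zeta>(1), of a] unfolding \<zeta>(2) by (metis norm_mult norm_power)
  moreover have "norm (poly (wronskian p q) b) \<le> (norm (poly q b))\<^sup>2"
    using db qb by (simp add: deriv_rational_fun norm_divide norm_power divide_le_eq)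
  ultimately have "(norm ?\<zeta>)\<^sup>2 * norm (poly (wronskian ?P ?Q) ?\<zeta>) \<le> (norm ?\<zeta>)\<^sup>2 * norm ((poly ?Q ?\<zeta>)\<^sup>2)"
    by (metis mult.commute mult_left_mono norm_ge_zero zero_le_power)
  then have "norm (poly (wronskian ?P ?Q) ?\<zeta>) \<le> norm ((poly ?Q ?\<zeta>)\<^sup>2)" using \<zeta>(1) by simp
  then have "norm (deriv (rational_fun ?P ?Q) ?\<zeta>) \<le> 1"
    using Q0 by (simp add: deriv_rational_fun norm_divide divide_le_eq)
  then show ?thesis using Q0 fixed by (simp add: nonrepelling_def)
qed

text \<open>The quotient of the two coefficients is the derivative of \<open>r\<close> at
  \<open>a\<close>, so the multiplier of \<open>a\<close> reappears at infinity.\<close>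

lemma num_den_nonrepelling_at_infinity:
  assumes a: "a \<in> nonrepelling p q"
  shows "norm (coeff (den_at n a p q) (n - 1)) \<le> norm (lead_coeff (num_at n a q))"
proof -
  have qa: "poly q a \<noteq> 0" and ga: "conj_map p q a = a" and da: "norm (deriv (rational_fun p q) a) \<le> 1"
    using a by (auto simp: nonrepelling_def)
  interpret fixed_infinity "num_at n a q" "den_at n a p q" n
    by (rule fixed_infinity_num_den[OF qa ga])
  have pa: "poly p a = cnj a * poly q a"
    using ga qa by (simp add: conj_map_eq_iff rational_fun_def field_simps)
  have 1: "lead_coeff (num_at n a q) = poly q a"
    unfolding deg_p by (simp add: num_at_def coeff_invert_at poly_0_coeff_0[symmetric] poly_pcompose)
  have "coeff (pcompose s [:a, 1:]) 1 = poly (pderiv s) a" for s :: "complex poly"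
  proof -
    have "coeff (pcompose s [:a, 1:]) 1 = poly (pderiv (pcompose s [:a, 1:])) 0"
      by (simp add: poly_0_coeff_0 coeff_pderiv)
    also have "\<dots> = poly (pderiv s) a" by (simp add: pderiv_pcompose poly_pcompose pderiv_pCons)
    finally show ?thesis .
  qed
  then have 2: "coeff (den_at n a p q) (n - 1) = poly (pderiv p) a - cnj a * poly (pderiv q) a"
    using n_ge_2 by (simp add: den_at_def coeff_invert_at pderiv_diff pderiv_smult)
  have "poly (wronskian p q) a = poly q a * (poly (pderiv p) a - cnj a * poly (pderiv q) a)"
    by (simp add: wronskian_def pa algebra_simps)
  then show ?thesis unfolding 1 2 using da qa
    by (simp add: deriv_rational_fun norm_divide norm_mult power2_eq_square divide_le_eq)
qed

end

section \<open>Infinity as a non-repelling fixed point, and the bound by critical points\<close>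

context fixed_infinity
begin

lemma rational_pair: "rational_pair p q n"
  using deg_p deg_q n_ge_2 no_common_root by unfold_locales auto

text \<open>A vanishing coefficient of degree \<open>n - 1\<close> in \<open>q\<close> means that
  infinity is itself critical, which costs a finite critical point.\<close>

lemma degree_wronskian: "degree (wronskian p q) \<le> 2 * n - 2"
  and degree_wronskian_less: "coeff q (n - 1) = 0 \<Longrightarrow> degree (wronskian p q) < 2 * n - 2"
proof -
  have bound: "degree (wronskian p q) \<le> n - 1 + degree q"
    unfolding wronskian_def
  proof (rule degree_diff_le)
    show "degree (pderiv p * q) \<le> n - 1 + degree q"
      using degree_mult_le[of "pderiv p" q] deg_p by (simp add: degree_pderiv)
    show "degree (p * pderiv q) \<le> n - 1 + degree q"
    proof (cases "degree q = 0")
      case True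
      then obtain c where "q = [:c:]" using degree_eq_zeroE by blast
      then show ?thesis by simp
    next
      case False
      then show ?thesis using degree_mult_le[of p "pderiv q"] deg_p n_ge_2 by (simp add: degree_pderiv)
    qed
  qed
  then show "degree (wronskian p q) \<le> 2 * n - 2" using deg_q by simp
  assume "coeff q (n - 1) = 0"
  then have "degree q \<noteq> n - 1" using q_nonzero by (metis leading_coeff_0_iff)
  then show "degree (wronskian p q) < 2 * n - 2" using bound deg_q by linarith
qed

text \<open>Infinity becomes the point 0, where the derivative is
  \<open>coeff q (n - 1) / lead_coeff p\<close>; hence the form of \<open>inf\<close> and of the
  criterion for 0 to be critical.\<close>

lemma zero_nonrepelling_num_den:
  assumes inf: "norm (coeff q (n - 1)) \<le> norm (lead_coeff p)"
  shows "0 \<in> nonrepelling (num_at n a q) (den_at n a p q)"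
    and "poly (wronskian (num_at n a q) (den_at n a p q)) 0 = 0 \<Longrightarrow> coeff q (n - 1) = 0"
proof -
  let ?P = "num_at n a q" and ?Q = "den_at n a p q"
  have p0: "lead_coeff p \<noteq> 0" using deg_p n_ge_2 by auto
  have sub: "coeff (pcompose q [:a, 1:]) n = 0" "coeff (pcompose q [:a, 1:]) (n - 1) = coeff q (n - 1)"
  proof -
    show "coeff (pcompose q [:a, 1:]) n = 0" using deg_q by (simp add: coeff_eq_0 degree_pcompose)
    show "coeff (pcompose q [:a, 1:]) (n - 1) = coeff q (n - 1)"
    proof (cases "degree q = n - 1")
      case True
      then show ?thesis using lead_coeff_comp[of "[:a, 1:]" q] by (simp add: degree_pcompose)
    next
      case False
      then show ?thesis using deg_q by (simp add: coeff_eq_0 degree_pcompose)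
    qed
  qed
  have degd: "degree (p - smult (cnj a) q) = n"
    using deg_p deg_q degree_smult_le[of "cnj a" q]
    by (simp only: diff_conv_add_uminus) (subst degree_add_eq_left; simp)
  have "coeff (pcompose (p - smult (cnj a) q) [:a, 1:]) n = lead_coeff (p - smult (cnj a) q)"
    using lead_coeff_comp[of "[:a, 1:]" "p - smult (cnj a) q"] degd by (simp add: degree_pcompose)
  also have "\<dots> = lead_coeff p" using degd deg_p deg_q by (simp add: coeff_eq_0)
  finally have Q0: "poly ?Q 0 = lead_coeff p" by (simp add: den_at_def poly_0_coeff_0 coeff_invert_at)
  have P0: "poly ?P 0 = 0" using sub by (simp add: num_at_def poly_0_coeff_0 coeff_invert_at)
  have P1: "poly (pderiv ?P) 0 = coeff q (n - 1)"
    using sub n_ge_2 by (simp add: num_at_def poly_0_coeff_0 coeff_pderiv coeff_invert_at)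
  have W: "poly (wronskian ?P ?Q) 0 = coeff q (n - 1) * lead_coeff p"
    by (simp add: wronskian_def P0 P1 Q0)
  show "coeff q (n - 1) = 0" if "poly (wronskian ?P ?Q) 0 = 0" using that W p0 by simp
  show "0 \<in> nonrepelling ?P ?Q"
    using p0 inf by (simp add: nonrepelling_def Q0 conj_map_def rational_fun_def P0 deriv_rational_fun W
        norm_divide norm_mult power2_eq_square divide_le_eq)
qed

text \<open>With \<open>2 * n - 2\<close> points in \<open>X\<close>, their critical points would be
  all roots of the Wronskian. Infinity, a finite point in the coordinate centred at
  \<open>a\<close>, attracts a critical point too, and this one would have two limits.\<close>

theorem card_nonrepelling_fixed_infinity:
  assumes inf: "norm (coeff q (n - 1)) \<le> norm (lead_coeff p)"
    and X: "finite X" "X \<subseteq> nonrepelling p q"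
  shows "card X \<le> 2 * n - 3"
proof (rule ccontr)
  assume "\<not> ?thesis"
  then have cX: "card X \<ge> 2 * n - 2" by simp
  then have "card X \<ge> 2" using n_ge_2 by simp
  then obtain a b where ab: "a \<in> X" "b \<in> X" "a \<noteq> b"
    by (metis card_2_iff' obtain_subset_with_card_n subsetD)
  let ?W = "wronskian p q"
  have "\<exists>c. c \<in> basin p q x \<and> poly ?W c = 0" if "x \<in> X" for x
  proof -
    obtain y where "y \<in> X" "x \<noteq> y" using ab by metis
    then show ?thesis using nonrepelling_attracts_critical[of x y] X(2) that by blast
  qed
  then obtain c where c: "\<And>x. x \<in> X \<Longrightarrow> c x \<in> basin p q x" "\<And>x. x \<in> X \<Longrightarrow> poly ?W (c x) = 0" by metis
  have "inj_on c X" by (rule inj_onI) (metis c(1) basin_disjoint)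
  then have card: "card (c ` X) = card X" by (rule card_image)
  have finW: "finite {z. poly ?W z = 0}" by (rule poly_roots_finite[OF wronskian_nonzero])
  have sub: "c ` X \<subseteq> {z. poly ?W z = 0}" using c(2) by blast
  have "card {z. poly ?W z = 0} \<le> degree ?W" by (rule card_poly_roots_bound[OF wronskian_nonzero])
  then have degW: "degree ?W = 2 * n - 2" and "card (c ` X) = card {z. poly ?W z = 0}"
    using degree_wronskian cX card card_mono[OF finW sub] by linarith+
  then have roots: "c ` X = {z. poly ?W z = 0}" by (intro card_subset_eq[OF finW sub])
  interpret R: rational_pair p q n by (rule rational_pair)
  let ?P = "num_at n a q" and ?Q = "den_at n a p q"
  let ?g = "conj_map p q" and ?G = "conj_map ?P ?Q"
  have a: "poly q a \<noteq> 0" "?g a = a" using ab(1) X(2) by (auto simp: nonrepelling_def)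
  interpret T: fixed_infinity ?P ?Q n by (rule R.fixed_infinity_num_den[OF a])
  have "1 / (b - a) \<in> nonrepelling ?P ?Q" using R.nonrepelling_num_den[of b a] ab X(2) by auto
  then obtain c' where c': "c' \<in> basin ?P ?Q 0" "poly (wronskian ?P ?Q) c' = 0"
    using T.nonrepelling_attracts_critical[OF zero_nonrepelling_num_den(1)[OF inf], of "1 / (b - a)"] ab(3) by auto
  \<comment> \<open>If infinity were critical, the degree of the Wronskian would drop below the
    value \<open>2 * n - 2\<close> just established.\<close>
  have "c' \<noteq> 0" using c'(2) zero_nonrepelling_num_den(2)[OF inf] degree_wronskian_less degW by (metis less_irrefl)
  then have "poly ?W (a + 1 / c') = 0" using R.wronskian_num_den[of c' a] c'(2) by simp
  then obtain x where x: "x \<in> X" "c x = a + 1 / c'" using roots by (metis (mono_tags) imageE mem_Collect_eq)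
  have gq: "poly q ((?g ^^ k) (c x)) \<noteq> 0" for k using c(1)[OF x(1)] by (simp add: basin_def)
  have Gq: "poly ?Q ((?G ^^ k) c') \<noteq> 0" for k using c'(1) by (simp add: basin_def)
  have orbit: "(?g ^^ k) (c x) \<noteq> a \<and> (?G ^^ k) c' = 1 / ((?g ^^ k) (c x) - a)" for k
  proof (induction k)
    case 0
    show ?case using x \<open>c' \<noteq> 0\<close> by simp
  next
    case (Suc k)
    note C = R.conj_map_num_den[OF gq[of k] conjunct1[OF Suc]]
    have "poly ?Q (1 / ((?g ^^ k) (c x) - a)) \<noteq> 0" using Gq[of k] Suc by metis
    then show ?case using C Suc by simp
  qed
  \<comment> \<open>The same orbit in both coordinates: the product of \<open>z - a\<close> and
    \<open>1 / (z - a)\<close> is constantly 1, but convergence to \<open>x\<close> and to infinity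
    would send it to 0.\<close>
  have "(\<lambda>k. ((?g ^^ k) (c x) - a) * (?G ^^ k) c') \<longlonglongrightarrow> (x - a) * 0"
    using c(1)[OF x(1)] c'(1) by (intro tendsto_intros) (auto simp: basin_def)
  moreover have "((?g ^^ k) (c x) - a) * (?G ^^ k) c' = 1" for k using orbit[of k] by simp
  ultimately have "(\<lambda>k::nat. 1::complex) \<longlonglongrightarrow> 0" by simp
  then show False by (simp add: LIMSEQ_const_iff)
qed

end

text \<open>One element of \<open>X\<close> is sent to infinity, where it counts as the
  non-repelling fixed point there; the others obey the bound \<open>2 * n - 3\<close>.\<close>

theorem (in rational_pair) card_nonrepelling:
  assumes X: "finite X" "X \<subseteq> nonrepelling p q"
  shows "card X \<le> 2 * n - 2"
proof (cases "X = {}")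
  case False
  then obtain a where a: "a \<in> X" by blast
  let ?P = "num_at n a q" and ?Q = "den_at n a p q"
  have aN: "a \<in> nonrepelling p q" using a X(2) by blast
  interpret T: fixed_infinity ?P ?Q n
    using aN by (intro fixed_infinity_num_den) (auto simp: nonrepelling_def)
  let ?Y = "(\<lambda>b. 1 / (b - a)) ` (X - {a})"
  have "card ?Y \<le> 2 * n - 3"
    by (rule T.card_nonrepelling_fixed_infinity[OF num_den_nonrepelling_at_infinity[OF aN]])
      (use X nonrepelling_num_den[of _ a] in auto)
  moreover have "card ?Y = card (X - {a})"
    by (rule card_image) (auto simp: inj_on_def)
  moreover have "card (X - {a}) = card X - 1" using a X(1) by simp
  ultimately show ?thesis using n_ge_2' by linarith
qed simp

subsection \<open>Counting zeros by continuous logarithms\<close>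

text \<open>Absence of zeros and of winding, expressed without loops or degree theory.\<close>

definition has_log :: "complex set \<Rightarrow> (complex \<Rightarrow> complex) \<Rightarrow> bool" where
  "has_log S f \<longleftrightarrow> (\<exists>L. continuous_on S L \<and> (\<forall>z\<in>S. f z = exp (L z)))"

lemma has_log_cong: "has_log S f \<Longrightarrow> (\<And>z. z \<in> S \<Longrightarrow> g z = f z) \<Longrightarrow> has_log S g"
  unfolding has_log_def by auto

lemma has_log_subset: "has_log T f \<Longrightarrow> S \<subseteq> T \<Longrightarrow> has_log S f"
  unfolding has_log_def by (meson continuous_on_subset subsetD)

lemma has_log_mult:
  assumes "has_log S f" "has_log S g"
  shows "has_log S (\<lambda>z. f z * g z)"
proof -
  obtain L M where "continuous_on S L" "\<forall>z\<in>S. f z = exp (L z)" "continuous_on S M" "\<forall>z\<in>S. g z = exp (M z)"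
    using assms unfolding has_log_def by blast
  then show ?thesis unfolding has_log_def
    by (intro exI[of _ "\<lambda>z. L z + M z"]) (auto simp: exp_add intro: continuous_intros)
qed

lemma has_log_divide:
  assumes "has_log S f" "has_log S g"
  shows "has_log S (\<lambda>z. f z / g z)"
proof -
  obtain L M where "continuous_on S L" "\<forall>z\<in>S. f z = exp (L z)" "continuous_on S M" "\<forall>z\<in>S. g z = exp (M z)"
    using assms unfolding has_log_def by blast
  then show ?thesis unfolding has_log_def
    by (intro exI[of _ "\<lambda>z. L z - M z"]) (auto simp: exp_diff intro: continuous_intros)
qed

lemma has_log_const: "c \<noteq> 0 \<Longrightarrow> has_log S (\<lambda>z. c)"
  unfolding has_log_def by (intro exI[of _ "\<lambda>z. Ln c"]) auto

lemma has_log_prod: "(\<And>i. i \<in> I \<Longrightarrow> has_log S (f i)) \<Longrightarrow> has_log S (\<lambda>z. \<Prod>i\<in>I. f i z)"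
  by (induction I rule: infinite_finite_induct) (auto intro: has_log_mult has_log_const)

lemma has_log_power: "has_log S f \<Longrightarrow> has_log S (\<lambda>z. f z ^ k)"
  by (induction k) (auto intro: has_log_mult has_log_const)

lemma has_log_Re_pos:
  assumes "continuous_on S f" "\<And>z. z \<in> S \<Longrightarrow> Re (f z) > 0"
  shows "has_log S f"
  unfolding has_log_def
proof (intro exI conjI ballI)
  have nn: "f z \<notin> \<real>\<^sub>\<le>\<^sub>0" if "z \<in> S" for z
    using assms(2)[OF that] by (auto simp: complex_nonpos_Reals_iff)
  then show "continuous_on S (\<lambda>z. Ln (f z))" by (intro continuous_intros assms(1)) auto
  show "f z = exp (Ln (f z))" if "z \<in> S" for z using assms(2)[OF that] by (subst exp_Ln) auto
qed

lemma has_log_contractible: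
  assumes "continuous_on S f" "contractible S" "\<And>z. z \<in> S \<Longrightarrow> f z \<noteq> 0"
  shows "has_log S f"
  using continuous_logarithm_on_contractible[OF assms] unfolding has_log_def by metis

lemma has_log_near_infinity:
  assumes "finite Z" "continuous_on (- Z) G" "\<And>z. z \<notin> Z \<Longrightarrow> G z \<noteq> 0"
    and "\<And>a. a \<in> Z \<Longrightarrow> \<exists>\<epsilon>>0. has_log (ball a \<epsilon> - {a}) G"
  shows "\<exists>R. has_log {z. norm z > R} G"
  using assms
proof (induction Z arbitrary: G rule: finite_induct)
  case empty
  then have "has_log UNIV G" by (intro has_log_contractible) (auto intro: starlike_imp_contractible starlike_UNIV)
  then show ?case using has_log_subset by blast
next
  case (insert a Z)
  obtain \<epsilon>1 where \<epsilon>1: "\<epsilon>1 > 0" "has_log (ball a \<epsilon>1 - {a}) G" using insert.prems(3)[of a] by auto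
  have "open (- Z)" using insert.hyps(1) finite_imp_closed by blast
  then obtain \<epsilon>2 where \<epsilon>2: "\<epsilon>2 > 0" "ball a \<epsilon>2 \<subseteq> - Z" using insert.hyps(2) openE by blast
  define \<epsilon> where "\<epsilon> = min \<epsilon>1 \<epsilon>2"
  have \<epsilon>: "\<epsilon> > 0" "ball a \<epsilon> \<inter> Z = {}" using \<epsilon>1 \<epsilon>2 by (auto simp: \<epsilon>_def)
  have "has_log (ball a \<epsilon> - {a}) G" by (rule has_log_subset[OF \<epsilon>1(2)]) (auto simp: \<epsilon>_def)
  then obtain L where L: "continuous_on (ball a \<epsilon> - {a}) L" "\<And>z. z \<in> ball a \<epsilon> - {a} \<Longrightarrow> G z = exp (L z)"
    unfolding has_log_def by blast
  \<comment> \<open>A cutoff equal to 0 near \<open>a\<close> and to 1 away from it. Replacing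
    \<open>exp L\<close> by \<open>exp (t * L)\<close> fills the puncture with the value 1 and
    creates no zeros.\<close>
  define t :: "complex \<Rightarrow> real" where "t z = max 0 (min 1 (4 * dist a z / \<epsilon> - 1))" for z
  have t0: "t z = 0" if "dist a z < \<epsilon> / 4" for z using that \<epsilon>(1) by (simp add: t_def field_simps)
  have t1: "t z = 1" if "dist a z > \<epsilon> / 2" for z using that \<epsilon>(1) by (simp add: t_def field_simps)
  have tc: "continuous_on S t" for S unfolding t_def using \<epsilon>(1) by (intro continuous_intros) auto
  define G' where "G' z = (if dist a z < \<epsilon> then exp (of_real (t z) * L z) else G z)" for z
  have G'G: "G' z = G z" if "dist a z > \<epsilon> / 2" for z
    using that \<epsilon>(1) t1[OF that] L(2)[of z] by (cases "z = a") (auto simp: G'_def)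
  have cont: "continuous_on (ball a (\<epsilon>/4) \<union> ((ball a \<epsilon> - {a}) \<union> (- insert a Z - cball a (\<epsilon>/2)))) G'"
  proof (intro continuous_on_open_Un)
    have "G' z = 1" if "z \<in> ball a (\<epsilon>/4)" for z using that t0[of z] \<epsilon>(1) by (simp add: G'_def)
    then show "continuous_on (ball a (\<epsilon>/4)) G'"
      by (intro continuous_on_eq[OF continuous_on_const[of _ 1]]) auto
    have "continuous_on (ball a \<epsilon> - {a}) (\<lambda>z. exp (of_real (t z) * L z))"
      by (intro continuous_intros L(1) tc)
    then show "continuous_on (ball a \<epsilon> - {a}) G'"
      by (rule continuous_on_eq) (auto simp: G'_def)
    have "continuous_on (- insert a Z - cball a (\<epsilon>/2)) G"
      using insert.prems(1) by (rule continuous_on_subset) auto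
    then show "continuous_on (- insert a Z - cball a (\<epsilon>/2)) G'"
      by (rule continuous_on_eq) (auto simp: G'G)
  qed (use insert.hyps(1) in \<open>auto intro!: open_Un open_Diff open_Compl finite_imp_closed\<close>)
  have "\<exists>R. has_log {z. norm z > R} G'"
  proof (rule insert.IH)
    show "continuous_on (- Z) G'" by (rule continuous_on_subset[OF cont]) (use \<epsilon> in auto)
    show "G' z \<noteq> 0" if "z \<notin> Z" for z
      using insert.prems(2)[of z] that \<epsilon>(1) by (cases "z = a") (auto simp: G'_def)
    fix b assume b: "b \<in> Z"
    obtain e where e: "e > 0" "has_log (ball b e - {b}) G" using insert.prems(3) b by auto
    have far: "dist a b \<ge> \<epsilon>" using b \<epsilon>(2) by (meson disjoint_iff linorder_not_le mem_ball)
    have "has_log (ball b (min e (\<epsilon>/2)) - {b}) G'"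
    proof (rule has_log_cong[OF has_log_subset[OF e(2)]])
      fix z assume "z \<in> ball b (min e (\<epsilon>/2)) - {b}"
      then have "dist a z > \<epsilon>/2" using far dist_triangle[of a b z] by (simp add: dist_commute)
      then show "G' z = G z" by (rule G'G)
    qed auto
    then show "\<exists>\<epsilon>>0. has_log (ball b \<epsilon> - {b}) G'" using e(1) \<epsilon>(1) by (intro exI[of _ "min e (\<epsilon>/2)"]) auto
  qed
  then obtain R where R: "has_log {z. norm z > R} G'" by blast
  have "has_log {z. norm z > max R (norm a + \<epsilon>)} G"
  proof (rule has_log_cong[OF has_log_subset[OF R]])
    fix z :: complex assume "z \<in> {z. norm z > max R (norm a + \<epsilon>)}"
    then have "dist a z > \<epsilon> / 2" using norm_triangle_ineq2[of z a] \<epsilon>(1) by (simp add: dist_norm norm_minus_commute)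
    then show "G z = G' z" using G'G by simp
  qed auto
  then show ?case by blast
qed

text \<open>Along a large circle, \<open>A - B\<close> times the logarithm of \<open>z\<close> minus
  \<open>L\<close> takes values in the discrete set of multiples of \<open>2 * pi * \<i>\<close>,
  hence is constant. After one turn \<open>L\<close> has returned to its value, which forces
  \<open>A = B\<close>.\<close>

lemma power_eq_power_times_log:
  fixes A B :: nat
  assumes h: "has_log {z. norm z > R} h" and eq: "\<And>z. norm z > R \<Longrightarrow> z ^ A = z ^ B * h z"
  shows "A = B"
proof -
  define \<rho> where "\<rho> = max R 0 + 1"
  have \<rho>: "\<rho> > 0" "\<rho> > R" by (auto simp: \<rho>_def)
  obtain L where L: "continuous_on {z. norm z > R} L" "\<And>z. norm z > R \<Longrightarrow> h z = exp (L z)"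
    using h unfolding has_log_def by auto
  define x where "x t = of_real (ln \<rho>) + \<i> * of_real t" for t :: real
  define z where "z t = exp (x t)" for t
  have nz: "norm (z t) > R" for t using \<rho> by (simp add: z_def x_def)
  define \<phi> where "\<phi> t = (of_nat A - of_nat B) * x t - L (z t)" for t
  have one: "exp (\<phi> t) = 1" for t
  proof -
    have "exp (of_nat A * x t) = exp (of_nat B * x t) * exp (L (z t))"
      using eq[OF nz[of t]] L(2)[OF nz[of t]] by (simp add: z_def exp_of_nat_mult)
    then show ?thesis by (simp add: \<phi>_def left_diff_distrib exp_diff)
  qed
  have "\<phi> constant_on UNIV"
  proof (rule continuous_discrete_range_constant)
    show "continuous_on UNIV \<phi>"
      unfolding \<phi>_def x_def
      by (intro continuous_intros continuous_on_compose2[OF L(1)]) (use nz in \<open>auto simp: z_def x_def intro!: continuous_intros\<close>)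
    show "\<exists>e>0. \<forall>u. u \<in> UNIV \<and> \<phi> u \<noteq> \<phi> t \<longrightarrow> e \<le> norm (\<phi> u - \<phi> t)" for t
    proof (intro exI[of _ "2 * pi"] conjI allI impI)
      fix u assume u: "u \<in> UNIV \<and> \<phi> u \<noteq> \<phi> t"
      obtain m :: int where m: "\<phi> u = \<phi> t + (of_int (2 * m) * pi) * \<i>"
        using one exp_eq[of "\<phi> u" "\<phi> t"] by auto
      then have "m \<noteq> 0" using u by auto
      then have "real_of_int \<bar>m\<bar> \<ge> 1" by linarith
      then show "2 * pi \<le> norm (\<phi> u - \<phi> t)" unfolding m by (simp add: norm_mult)
    qed auto
  qed auto
  then have "\<phi> 0 = \<phi> (2 * pi)" unfolding constant_on_def by (metis UNIV_I)
  moreover have "z 0 = z (2 * pi)" by (simp add: z_def x_def exp_add mult.commute)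
  ultimately have "(of_nat A - of_nat B) * (2 * pi * \<i>) = 0" by (simp add: \<phi>_def x_def algebra_simps)
  then show ?thesis by simp
qed

text \<open>Dividing out the local factors leaves a function with a continuous logarithm near each
  zero; it can be modified there to a non-vanishing function on the plane, which has a global
  logarithm. So no winding is left at infinity.\<close>

lemma zero_count:
  fixes \<phi> :: "complex \<Rightarrow> complex"
  assumes cont: "continuous_on UNIV \<phi>" and fin: "finite Zp" "finite Zm" and disj: "Zp \<inter> Zm = {}"
    and nz: "\<And>z. z \<notin> Zp \<union> Zm \<Longrightarrow> \<phi> z \<noteq> 0"
    and plus: "\<And>a. a \<in> Zp \<Longrightarrow> \<exists>\<epsilon>>0. \<exists>\<alpha>. \<alpha> \<noteq> 0 \<and> (\<forall>z\<in>ball a \<epsilon> - {a}. Re (\<phi> z / (\<alpha> * (z - a))) > 0)"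
    and minus: "\<And>b. b \<in> Zm \<Longrightarrow> \<exists>\<epsilon>>0. \<exists>\<beta>. \<beta> \<noteq> 0 \<and> (\<forall>z\<in>ball b \<epsilon> - {b}. Re (\<phi> z / (\<beta> * cnj (z - b))) > 0)"
    and inf: "\<gamma> \<noteq> 0" "\<And>z. norm z > R \<Longrightarrow> Re (\<phi> z / (\<gamma> * (z ^ k * cnj z ^ l))) > 0"
  shows "k + card Zm = l + card Zp"
proof -
  define fac where "fac a z = (if a \<in> Zp then z - a else cnj (z - a))" for a z
  let ?Z = "Zp \<union> Zm"
  have facc: "continuous_on S (fac a)" for S a by (cases "a \<in> Zp") (auto simp: fac_def intro!: continuous_intros)
  have fac0: "fac a z = 0 \<longleftrightarrow> z = a" for a z by (auto simp: fac_def)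
  define D where "D A z = (\<Prod>a\<in>A. fac a z)" for A z
  have Dc: "continuous_on S (D A)" for S A unfolding D_def by (intro continuous_intros facc)
  have D0: "D A z = 0 \<longleftrightarrow> z \<in> A" if "finite A" for A z using that by (auto simp: D_def fac0)
  have "\<exists>R. has_log {z. norm z > R} (\<lambda>z. \<phi> z / D ?Z z)"
  proof (rule has_log_near_infinity[of ?Z])
    show "continuous_on (- ?Z) (\<lambda>z. \<phi> z / D ?Z z)"
      by (intro continuous_intros continuous_on_subset[OF cont] Dc) (use D0[of ?Z] fin in auto)
    show "\<phi> z / D ?Z z \<noteq> 0" if "z \<notin> ?Z" for z using nz[OF that] D0[of ?Z] fin that by auto
    fix a assume a: "a \<in> ?Z"
    have "open (- (?Z - {a}))" using fin by (intro open_Compl finite_imp_closed) auto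
    then obtain e1 where e1: "e1 > 0" "ball a e1 \<subseteq> - (?Z - {a})" by (metis ComplI DiffD2 insertI1 openE)
    obtain e2 \<alpha> where e2: "e2 > 0" "\<alpha> \<noteq> 0" "\<And>z. z \<in> ball a e2 - {a} \<Longrightarrow> Re (\<phi> z / (\<alpha> * fac a z)) > 0"
      using plus[of a] minus[of a] a disj unfolding fac_def by (cases "a \<in> Zp") (auto; metis)+
    define e where "e = min e1 e2"
    have 1: "has_log (ball a e - {a}) (\<lambda>z. \<phi> z / (\<alpha> * fac a z))"
      by (rule has_log_Re_pos)
        (use e2 fac0 in \<open>auto simp: e_def intro!: continuous_intros continuous_on_subset[OF cont] facc\<close>)
    have 2: "has_log (ball a e - {a}) (D (?Z - {a}))"
      by (rule has_log_subset[OF has_log_contractible[of "ball a e"]])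
        (use e1 D0[of "?Z - {a}"] fin in \<open>auto simp: e_def intro!: Dc convex_imp_contractible\<close>)
    have "has_log (ball a e - {a}) (\<lambda>z. \<alpha> * (\<phi> z / (\<alpha> * fac a z)) / D (?Z - {a}) z)"
      by (rule has_log_divide[OF has_log_mult[OF has_log_const[OF e2(2)] 1] 2])
    moreover have "D ?Z z = fac a z * D (?Z - {a}) z" for z
      unfolding D_def using a fin by (intro prod.remove) auto
    ultimately have "has_log (ball a e - {a}) (\<lambda>z. \<phi> z / D ?Z z)"
      using e2(2) by simp
    then show "\<exists>\<epsilon>>0. has_log (ball a \<epsilon> - {a}) (\<lambda>z. \<phi> z / D ?Z z)"
      using e1(1) e2(1) by (intro exI[of _ e]) (auto simp: e_def)
  qed (use fin in auto)
  then obtain R1 where R1: "has_log {z. norm z > R1} (\<lambda>z. \<phi> z / D ?Z z)" by blast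
  obtain R2 where R2: "\<And>a. a \<in> ?Z \<Longrightarrow> norm a \<le> R2"
    using finite_imp_bounded[of ?Z] fin unfolding bounded_iff by blast
  define T where "T = max (max R R1) (max R2 0)"
  let ?S = "{z. norm z > T}"
  have S0: "z \<noteq> 0" if "z \<in> ?S" for z using that by (auto simp: T_def)
  define \<psi> where "\<psi> z = \<phi> z / (\<gamma> * (z ^ k * cnj z ^ l))" for z
  define h1 where "h1 z = (\<Prod>a\<in>Zp. 1 - a / z)" for z
  define h2 where "h2 z = (\<Prod>a\<in>Zm. cnj (1 - a / z))" for z
  have pos: "Re (1 - a / z) > 0" if "z \<in> ?S" "a \<in> ?Z" for a z
  proof -
    have "norm a < norm z" using that R2[of a] by (auto simp: T_def)
    then have "norm (a / z) < 1" using S0[OF that(1)] by (simp add: norm_divide)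
    then show ?thesis using complex_Re_le_cmod[of "a / z"] by simp
  qed
  have l\<psi>: "has_log ?S \<psi>" unfolding \<psi>_def
    by (rule has_log_Re_pos)
      (use inf S0 in \<open>auto simp: T_def intro!: continuous_intros continuous_on_subset[OF cont]\<close>)
  have l1: "has_log ?S h1" unfolding h1_def
    by (intro has_log_prod has_log_Re_pos continuous_intros) (use pos S0 in auto)
  have l2: "has_log ?S h2" unfolding h2_def
  proof (intro has_log_prod has_log_Re_pos)
    show "continuous_on ?S (\<lambda>z. cnj (1 - a / z))" for a
      by (intro continuous_intros) (use S0 in auto)
    show "Re (cnj (1 - a / z)) > 0" if "a \<in> Zm" "z \<in> ?S" for a z
      using pos[of z a] that by (simp only: cnj.sel) simp
  qed
  have lG: "has_log ?S (\<lambda>z. \<phi> z / D ?Z z)" by (rule has_log_subset[OF R1]) (auto simp: T_def)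
  \<comment> \<open>Since \<open>z * cnj z\<close> is positive, a factor \<open>cnj z\<close> may be
    traded for \<open>1 / z\<close>. The powers in \<open>h\<close> below are chosen to remove
    \<open>cnj z\<close> altogether.\<close>
  have ln: "has_log ?S (\<lambda>z. z * cnj z)"
  proof (rule has_log_Re_pos)
    show "Re (z * cnj z) > 0" if "z \<in> ?S" for z
      unfolding complex_norm_square[symmetric] using S0[OF that] by simp
  qed (intro continuous_intros)
  define h where "h z = (z * cnj z) ^ card Zm / (z * cnj z) ^ l * ((\<phi> z / D ?Z z) * (h1 z * h2 z) / (\<gamma> * \<psi> z))" for z
  have lh: "has_log ?S h" unfolding h_def
    by (intro has_log_mult has_log_divide has_log_power has_log_const l\<psi> l1 l2 lG ln inf(1))
  show ?thesis
  proof (rule power_eq_power_times_log[OF lh])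
    fix z :: complex assume "norm z > T"
    then have z: "z \<in> ?S" by simp
    note z0 = S0[OF z]
    have \<phi>0: "\<phi> z \<noteq> 0" using inf(2)[of z] z by (auto simp: T_def)
    have "(\<Prod>a\<in>Zp. z - a) = (\<Prod>a\<in>Zp. z * (1 - a / z))" using z0 by (intro prod.cong) (auto simp: field_simps)
    then have D1: "(\<Prod>a\<in>Zp. z - a) = z ^ card Zp * h1 z" by (simp add: h1_def prod.distrib)
    have "(\<Prod>a\<in>Zm. cnj (z - a)) = (\<Prod>a\<in>Zm. cnj z * cnj (1 - a / z))"
      using z0 by (intro prod.cong) (auto simp: field_simps)
    then have D2: "(\<Prod>a\<in>Zm. cnj (z - a)) = cnj z ^ card Zm * h2 z" by (simp add: h2_def prod.distrib)
    have "D ?Z z = (\<Prod>a\<in>Zp. fac a z) * (\<Prod>a\<in>Zm. fac a z)"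
      unfolding D_def using fin disj by (intro prod.union_disjoint) auto
    also have "(\<Prod>a\<in>Zp. fac a z) = (\<Prod>a\<in>Zp. z - a)" by (intro prod.cong) (auto simp: fac_def)
    also have "(\<Prod>a\<in>Zm. fac a z) = (\<Prod>a\<in>Zm. cnj (z - a))" using disj by (intro prod.cong) (auto simp: fac_def)
    finally have D: "D ?Z z = z ^ card Zp * h1 z * (cnj z ^ card Zm * h2 z)" unfolding D1 D2 .
    have "D ?Z z \<noteq> 0" using D0[of ?Z z] fin R2[of z] z by (auto simp: T_def)
    then have h0: "h1 z \<noteq> 0" "h2 z \<noteq> 0" using D by auto
    have quot: "(\<phi> z / D ?Z z) * (h1 z * h2 z) / (\<gamma> * \<psi> z) = (z ^ k * cnj z ^ l) / (z ^ card Zp * cnj z ^ card Zm)"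
      unfolding D \<psi>_def using \<phi>0 h0 z0 inf(1) by (simp add: field_simps)
    show "z ^ (k + card Zm) = z ^ (l + card Zp) * h z"
      unfolding h_def quot using z0 by (simp add: power_add power_mult_distrib field_simps)
  qed
qed

subsection \<open>Perturbation\<close>

lemma nonrepelling_eq: "nonrepelling p q = sense_reversing_zeros p q \<union> singular_zeros p q"
  by (auto simp: nonrepelling_def sense_reversing_zeros_def singular_zeros_def harmonic_zeros_def
      rational_harmonic_def conj_map_eq_iff)

lemma harmonic_zeros_eq:
  "harmonic_zeros p q = sense_preserving_zeros p q \<union> nonrepelling p q"
  "sense_preserving_zeros p q \<inter> nonrepelling p q = {}"
  by (auto simp: nonrepelling_def sense_preserving_zeros_def harmonic_zeros_def
      rational_harmonic_def conj_map_eq_iff)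

lemma rational_fun_perturb:
  assumes "poly q z \<noteq> 0"
  shows "rational_fun (p + s * q) q z = rational_fun p q z + poly s z"
    and "deriv (rational_fun (p + s * q) q) z = deriv (rational_fun p q) z + poly (pderiv s) z"
proof -
  show "rational_fun (p + s * q) q z = rational_fun p q z + poly s z"
    using assms by (simp add: rational_fun_def field_simps)
  have "wronskian (p + s * q) q = wronskian p q + pderiv s * q ^ 2"
    by (simp add: wronskian_def pderiv_add pderiv_mult power2_eq_square algebra_simps)
  then show "deriv (rational_fun (p + s * q) q) z = deriv (rational_fun p q) z + poly (pderiv s) z"
    using assms by (simp add: deriv_rational_fun field_simps)
qed

text \<open>The equation \<open>r z + c + e * z = cnj z\<close> is solved for the term
  \<open>D * (z - x)\<close>. As \<open>norm D > 1\<close>, dividing by \<open>D\<close> leaves room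
  for the perturbation, and the resulting map of a disc into itself has a Brouwer fixed
  point.\<close>

lemma sense_preserving_persists_at:
  assumes x: "x \<in> sense_preserving_zeros p q" and \<eta>: "\<eta> > 0"
  shows "\<exists>\<epsilon>>0. \<forall>c e. norm c < \<epsilon> \<longrightarrow> norm e < \<epsilon> \<longrightarrow>
    (\<exists>y\<in>sense_preserving_zeros (p + [:c, e:] * q) q. dist x y < \<eta>)"
proof -
  let ?r = "rational_fun p q"
  define D where "D = deriv ?r x"
  have qx: "poly q x \<noteq> 0" and rx: "?r x = cnj x" and Dx: "norm D > 1"
    using x by (auto simp: sense_preserving_zeros_def harmonic_zeros_def rational_harmonic_def D_def)
  \<comment> \<open>The surplus of \<open>norm D\<close> over 1 is split in four. For the self-map,
    the linearisation error and the perturbation take one part each; for the derivative, its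
    variation takes two and \<open>e\<close> takes one.\<close>
  define \<sigma> where "\<sigma> = (norm D - 1) / 4"
  have \<sigma>: "\<sigma> > 0" "norm D = 1 + 4 * \<sigma>" using Dx by (auto simp: \<sigma>_def field_simps)
  have "(?r has_derivative (*) D) (at x)"
    using rational_fun_has_deriv[OF qx, of p] deriv_rational_fun[OF qx, of p]
    by (simp add: has_field_derivative_def D_def)
  then obtain d1 where d1: "d1 > 0" "\<And>z. norm (z - x) < d1 \<Longrightarrow> norm (?r z - ?r x - D * (z - x)) \<le> \<sigma> * norm (z - x)"
    unfolding has_derivative_at_alt using \<sigma>(1) by blast
  obtain d2 where d2: "d2 > 0" "\<And>z. dist z x < d2 \<Longrightarrow> poly q z \<noteq> 0"
    using nonpole_neighbourhood[OF qx] by blast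
  have "isCont (\<lambda>z. poly (wronskian p q) z / (poly q z)\<^sup>2) x" using qx by (intro continuous_intros) auto
  then obtain d3 where d3: "d3 > 0" "\<And>z. dist z x < d3 \<Longrightarrow>
      dist (poly (wronskian p q) z / (poly q z)\<^sup>2) (poly (wronskian p q) x / (poly q x)\<^sup>2) < 2 * \<sigma>"
    using \<sigma>(1) unfolding continuous_at_eps_delta by (meson mult_pos_pos zero_less_numeral)
  define \<delta> where "\<delta> = min (min d1 d2) (min d3 \<eta>) / 2"
  have \<delta>: "\<delta> > 0" "\<delta> < d1" "\<delta> < d2" "\<delta> < d3" "\<delta> < \<eta>" using d1 d2 d3 \<eta> by (auto simp: \<delta>_def)
  have qz: "poly q z \<noteq> 0" if "z \<in> cball x \<delta>" for z using d2(2)[of z] that \<delta> by (simp add: dist_commute)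
  have dz: "norm (deriv ?r z) > 1 + 2 * \<sigma>" if "z \<in> cball x \<delta>" for z
  proof -
    have "norm (deriv ?r z - D) < 2 * \<sigma>"
      using d3(2)[of z] that \<delta> qz[OF that] qx by (simp add: D_def deriv_rational_fun dist_norm norm_minus_commute)
    then show ?thesis using norm_triangle_ineq2[of D "deriv ?r z"] \<sigma>(2) by (simp add: norm_minus_commute)
  qed
  define K where "K = 1 + norm x + \<delta>"
  have K: "K > 0" using \<delta>(1) by (simp add: K_def add_pos_nonneg add_nonneg_pos)
  define \<epsilon> where "\<epsilon> = min \<sigma> (\<sigma> * \<delta> / K)"
  have \<epsilon>: "\<epsilon> > 0" using \<sigma>(1) \<delta>(1) K by (simp add: \<epsilon>_def)
  show ?thesis
  proof (intro exI[of _ \<epsilon>] conjI allI impI)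
    fix c e :: complex assume c: "norm c < \<epsilon>" and e: "norm e < \<epsilon>"
    define \<Phi> where "\<Phi> z = x + (cnj (z - x) - c - e * z - (?r z - ?r x - D * (z - x))) / D" for z
    have D0: "D \<noteq> 0" using Dx by auto
    obtain y where y: "y \<in> cball x \<delta>" "\<Phi> y = y"
    proof (rule brouwer_ball[OF \<delta>(1), of x \<Phi>])
      have "continuous_on (cball x \<delta>) ?r"
        using qz continuous_rational_fun by (intro continuous_at_imp_continuous_on) auto
      then show "continuous_on (cball x \<delta>) \<Phi>" unfolding \<Phi>_def using D0 by (intro continuous_intros) auto
      show "\<Phi> \<in> cball x \<delta> \<rightarrow> cball x \<delta>"
      proof
        fix z assume z: "z \<in> cball x \<delta>"
        then have nz: "norm (z - x) \<le> \<delta>" by (simp add: dist_norm norm_minus_commute)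
        have 1: "norm (?r z - ?r x - D * (z - x)) \<le> \<sigma> * \<delta>"
          using d1(2)[of z] nz \<delta>(2) mult_left_mono[OF nz, of \<sigma>] \<sigma>(1) by linarith
        have "norm z \<le> norm x + \<delta>" using nz norm_triangle_ineq2[of z x] by linarith
        then have "norm c + norm e * norm z \<le> \<epsilon> + \<epsilon> * (norm x + \<delta>)"
          using c e \<epsilon> by (intro add_mono mult_mono) auto
        also have "\<dots> = \<epsilon> * K" by (simp add: K_def algebra_simps)
        also have "\<dots> \<le> \<sigma> * \<delta> / K * K" using K by (intro mult_right_mono) (auto simp: \<epsilon>_def)
        finally have 2: "norm c + norm (e * z) \<le> \<sigma> * \<delta>" using K by (simp add: norm_mult)
        let ?N = "cnj (z - x) - c - e * z - (?r z - ?r x - D * (z - x))"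
        have "norm ?N \<le> norm (cnj (z - x)) + norm c + norm (e * z) + norm (?r z - ?r x - D * (z - x))"
          by (intro order_trans[OF norm_triangle_ineq4] add_mono order_refl)
        also have "\<dots> \<le> \<delta> + \<sigma> * \<delta> + \<sigma> * \<delta>"
          using nz 1 2 unfolding complex_mod_cnj by linarith
        also have "\<dots> \<le> norm D * \<delta>" using \<sigma> \<delta>(1) by (simp add: algebra_simps)
        finally have "norm (?N / D) \<le> \<delta>" using D0 by (simp add: norm_divide divide_le_eq mult.commute)
        then show "\<Phi> z \<in> cball x \<delta>" by (simp add: \<Phi>_def dist_norm)
      qed
    qed
    have "cnj (y - x) - c - e * y - (?r y - ?r x - D * (y - x)) = (y - x) * D"
      using y(2) D0 unfolding \<Phi>_def by (simp add: field_simps)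
    then have ry: "?r y + c + e * y = cnj y" using rx by (simp add: algebra_simps)
    have "norm (deriv ?r y + e) > 1"
      using dz[OF y(1)] norm_triangle_ineq2[of "deriv ?r y" "- e"] e \<sigma>(1) by (simp add: \<epsilon>_def)
    then have "norm (deriv (rational_fun (p + [:c, e:] * q) q) y) > 1"
      unfolding rational_fun_perturb(2)[OF qz[OF y(1)]] by (simp add: pderiv_pCons)
    moreover have "rational_fun (p + [:c, e:] * q) q y = cnj y"
      unfolding rational_fun_perturb(1)[OF qz[OF y(1)]] using ry by (simp add: algebra_simps)
    ultimately have "y \<in> sense_preserving_zeros (p + [:c, e:] * q) q"
      using qz[OF y(1)]
      unfolding sense_preserving_zeros_def harmonic_zeros_def rational_harmonic_def by auto
    moreover have "dist x y < \<eta>" using y(1) \<delta>(5) by simp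
    ultimately show "\<exists>y\<in>sense_preserving_zeros (p + [:c, e:] * q) q. dist x y < \<eta>" by blast
  qed (rule \<epsilon>)
qed

lemma sense_preserving_persist:
  assumes X: "finite X" "X \<subseteq> sense_preserving_zeros p q"
  obtains \<epsilon> where "\<epsilon> > 0" "\<And>c e. norm c < \<epsilon> \<Longrightarrow> norm e < \<epsilon> \<Longrightarrow>
    \<exists>Y. finite Y \<and> Y \<subseteq> sense_preserving_zeros (p + [:c, e:] * q) q \<and> card Y = card X"
proof -
  obtain \<eta> where \<eta>: "\<eta> > 0" "\<And>a b. a \<in> X \<Longrightarrow> b \<in> X \<Longrightarrow> a \<noteq> b \<Longrightarrow> 2 * \<eta> \<le> dist a b"
  proof -
    have "\<exists>d>0. \<forall>b\<in>X. b \<noteq> a \<longrightarrow> d \<le> dist a b" for a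
      using finite_set_avoid[OF X(1)] by blast
    then obtain d where d: "\<And>a. d a > 0" "\<And>a b. b \<in> X \<Longrightarrow> b \<noteq> a \<Longrightarrow> d a \<le> dist a b" by metis
    show ?thesis
    proof (rule that[of "Min (insert 1 (d ` X)) / 2"])
      show "Min (insert 1 (d ` X)) / 2 > 0" using X(1) d(1) by (simp add: Min_gr_iff)
      fix a b assume ab: "a \<in> X" "b \<in> X" "a \<noteq> b"
      have "Min (insert 1 (d ` X)) \<le> d a" by (rule Min_le) (use X(1) ab in auto)
      then show "2 * (Min (insert 1 (d ` X)) / 2) \<le> dist a b" using d(2)[OF ab(2) ab(3)[symmetric]] by linarith
    qed
  qed
  have "\<forall>x\<in>X. \<exists>\<epsilon>>0. \<forall>c e. norm c < \<epsilon> \<longrightarrow> norm e < \<epsilon> \<longrightarrow>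
    (\<exists>y\<in>sense_preserving_zeros (p + [:c, e:] * q) q. dist x y < \<eta>)"
    using sense_preserving_persists_at[OF _ \<eta>(1)] X(2) by blast
  then obtain E where E: "\<And>x. x \<in> X \<Longrightarrow> E x > 0" "\<And>x c e. x \<in> X \<Longrightarrow> norm c < E x \<Longrightarrow> norm e < E x \<Longrightarrow>
    \<exists>y\<in>sense_preserving_zeros (p + [:c, e:] * q) q. dist x y < \<eta>" by metis
  show ?thesis
  proof (rule that[of "Min (insert 1 (E ` X))"])
    show "Min (insert 1 (E ` X)) > 0" using X(1) E(1) by (simp add: Min_gr_iff)
    fix c e :: complex assume c: "norm c < Min (insert 1 (E ` X))" "norm e < Min (insert 1 (E ` X))"
    have "\<exists>y\<in>sense_preserving_zeros (p + [:c, e:] * q) q. dist x y < \<eta>" if "x \<in> X" for x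
      by (rule E(2)[OF that]) (use c X(1) that in auto)
    then obtain Y where Y: "\<And>x. x \<in> X \<Longrightarrow> Y x \<in> sense_preserving_zeros (p + [:c, e:] * q) q"
      "\<And>x. x \<in> X \<Longrightarrow> dist x (Y x) < \<eta>" by metis
    have "inj_on Y X"
    proof (rule inj_onI, rule ccontr)
      fix a b assume "a \<in> X" "b \<in> X" "Y a = Y b" "a \<noteq> b"
      then show False using \<eta>(2)[of a b] Y(2)[of a] Y(2)[of b] dist_triangle2[of a b "Y a"] by simp
    qed
    then show "\<exists>Y. finite Y \<and> Y \<subseteq> sense_preserving_zeros (p + [:c, e:] * q) q \<and> card Y = card X"
      using Y(1) X(1) by (intro exI[of _ "Y ` X"]) (auto simp: card_image)
  qed
qed

context rational_pair
begin

lemma q_nonzero': "q \<noteq> 0"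
proof
  assume q: "q = 0"
  then have "degree p \<noteq> 0" using max_deg n_ge_2' by auto
  then obtain z where "poly p z = 0"
    using fundamental_theorem_of_algebra[of p] constant_degree[of p] by auto
  then show False using no_common_root'[of z] q by simp
qed

lemma finite_poles: "finite {z. poly q z = 0}"
  by (rule poly_roots_finite[OF q_nonzero'])

lemma open_nonpoles: "open {z. poly q z \<noteq> 0}"
  by (intro open_Collect_neq continuous_intros)

lemma connected_nonpoles: "connected {z. poly q z \<noteq> 0}"
proof -
  have "connected (UNIV - {z. poly q z = 0})"
    by (rule connected_open_delete_finite) (auto simp: finite_poles)
  moreover have "UNIV - {z. poly q z = 0} = {z. poly q z \<noteq> 0}" by auto
  ultimately show ?thesis by simp
qed

text \<open>\<open>V\<close> is the numerator of the second derivative. If it vanished,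
  \<open>r\<close> would be affine, so \<open>q\<close> would divide \<open>p\<close>; without
  common roots \<open>q\<close> is constant and the degree is at most 1.\<close>

lemma derivative_nonconstant:
  obtains V where "V \<noteq> 0" "\<And>z. poly q z \<noteq> 0 \<Longrightarrow>
    ((\<lambda>z. poly (wronskian p q) z / (poly q z)\<^sup>2) has_field_derivative poly V z / (poly q z) ^ 3) (at z)"
proof -
  let ?W = "wronskian p q" and ?U = "{z. poly q z \<noteq> 0}"
  define V where "V = pderiv ?W * q - 2 * ?W * pderiv q"
  have dd: "((\<lambda>z. poly ?W z / (poly q z)\<^sup>2) has_field_derivative poly V z / (poly q z) ^ 3) (at z)"
    if "poly q z \<noteq> 0" for z
    by (rule derivative_eq_intros refl poly_DERIV)+
      (use that in \<open>auto simp: V_def field_simps power2_eq_square power3_eq_cube\<close>)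
  have "V \<noteq> 0"
  proof
    assume V: "V = 0"
    have c1: "continuous_on ?U (\<lambda>z. poly ?W z / (poly q z)\<^sup>2)" by (intro continuous_intros) auto
    have d1: "\<forall>z\<in>?U - {}. ((\<lambda>z. poly ?W z / (poly q z)\<^sup>2) has_field_derivative 0) (at z)"
      using dd unfolding V by simp
    obtain d where d: "\<And>z. z \<in> ?U \<Longrightarrow> poly ?W z / (poly q z)\<^sup>2 = d"
      by (rule DERIV_zero_connected_constant[OF connected_nonpoles open_nonpoles finite.emptyI c1 d1]) blast
    have c2: "continuous_on ?U (\<lambda>z. rational_fun p q z - d * z)"
      by (intro continuous_intros holomorphic_on_imp_continuous_on[OF rational_fun_holomorphic])
    have d2: "\<forall>z\<in>?U - {}. ((\<lambda>z. rational_fun p q z - d * z) has_field_derivative 0) (at z)"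
    proof
      fix z assume "z \<in> ?U - {}"
      then have "poly q z \<noteq> 0" "poly ?W z / (poly q z)\<^sup>2 = d" using d by auto
      then show "((\<lambda>z. rational_fun p q z - d * z) has_field_derivative 0) (at z)"
        using DERIV_diff[OF rational_fun_has_deriv[of q z p] DERIV_cmult_Id[of d z]] by simp
    qed
    obtain b where b: "\<And>z. z \<in> ?U \<Longrightarrow> rational_fun p q z - d * z = b"
      by (rule DERIV_zero_connected_constant[OF connected_nonpoles open_nonpoles finite.emptyI c2 d2]) blast
    have "poly (p - [:b, d:] * q) z = 0" if "z \<in> ?U" for z
      using b[OF that] that by (simp add: rational_fun_def field_simps)
    then have "?U \<subseteq> {z. poly (p - [:b, d:] * q) z = 0}" by blast
    moreover have "infinite ?U"
      using finite_poles infinite_UNIV_char_0 by (metis Collect_neg_eq finite_compl)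
    ultimately have p: "p = [:b, d:] * q" using poly_roots_finite finite_subset by (metis right_minus_eq)
    have "degree q = 0"
    proof (rule ccontr)
      assume "degree q \<noteq> 0"
      then obtain z where "poly q z = 0"
        using fundamental_theorem_of_algebra[of q] constant_degree[of q] by auto
      then show False using no_common_root'[of z] p by simp
    qed
    moreover have "degree p \<le> 1 + degree q"
      unfolding p by (rule order_trans[OF degree_mult_le]) simp
    ultimately show False using max_deg n_ge_2' by simp
  qed
  then show ?thesis using that dd by blast
qed

text \<open>Off the finitely many roots of \<open>V\<close>, the derivative of \<open>r\<close> is
  locally biholomorphic and maps the curve into the unit circle, a null set.\<close>

lemma negligible_critical_curve: "negligible {z. poly q z \<noteq> 0 \<and> norm (deriv (rational_fun p q) z) = 1}"
proof -
  let ?W = "wronskian p q" and ?U = "{z. poly q z \<noteq> 0}"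
  obtain V where V: "V \<noteq> 0" and dV: "\<And>z. poly q z \<noteq> 0 \<Longrightarrow>
      ((\<lambda>z. poly ?W z / (poly q z)\<^sup>2) has_field_derivative poly V z / (poly q z) ^ 3) (at z)"
    by (rule derivative_nonconstant) blast
  define f where "f z = poly ?W z / (poly q z)\<^sup>2" for z
  define K where "K = {z. poly q z \<noteq> 0 \<and> norm (f z) = 1}"
  have fd: "(f has_field_derivative poly V z / (poly q z) ^ 3) (at z)" if "z \<in> ?U" for z
    unfolding f_def[abs_def] by (rule dV) (use that in simp)
  have hol: "f holomorphic_on ?U" unfolding holomorphic_on_open[OF open_nonpoles] using fd by blast
  have "negligible (K \<inter> {z. poly V z \<noteq> 0})"
  proof (rule locally_negligible_alt[THEN iffD2], rule ballI)
    fix z assume z: "z \<in> K \<inter> {z. poly V z \<noteq> 0}"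
    then have zU: "z \<in> ?U" by (simp add: K_def)
    have "deriv f z \<noteq> 0" using DERIV_imp_deriv[OF fd[OF zU]] z zU by simp
    then obtain r where r: "r > 0" "ball z r \<subseteq> ?U" "open (f ` ball z r)" "inj_on f (ball z r)"
      using has_complex_derivative_locally_invertible[OF hol zU open_nonpoles] by blast
    obtain g where g: "g holomorphic_on f ` ball z r" "\<And>x. x \<in> ball z r \<Longrightarrow> g (f x) = x"
      by (rule holomorphic_has_inverse[OF holomorphic_on_subset[OF hol r(2)] open_ball r(4)]) blast
    have "negligible (g ` (sphere 0 1 \<inter> f ` ball z r))"
    proof (rule negligible_differentiable_image_negligible)
      show "negligible (sphere (0::complex) 1 \<inter> f ` ball z r)"
        by (rule negligible_subset[OF negligible_sphere]) auto
      have "g differentiable at x" if "x \<in> f ` ball z r" for x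
        using g(1) r(3) that field_differentiable_imp_differentiable holomorphic_on_imp_differentiable_at by blast
      then show "g differentiable_on sphere 0 1 \<inter> f ` ball z r"
        by (auto simp: differentiable_on_def intro: differentiable_at_withinI)
    qed simp
    moreover have "K \<inter> {z. poly V z \<noteq> 0} \<inter> ball z r \<subseteq> g ` (sphere 0 1 \<inter> f ` ball z r)"
    proof
      fix x assume "x \<in> K \<inter> {z. poly V z \<noteq> 0} \<inter> ball z r"
      then have x: "x \<in> ball z r" "norm (f x) = 1" by (auto simp: K_def)
      then have "f x \<in> sphere 0 1 \<inter> f ` ball z r" by simp
      then have "g (f x) \<in> g ` (sphere 0 1 \<inter> f ` ball z r)" by (rule imageI)
      then show "x \<in> g ` (sphere 0 1 \<inter> f ` ball z r)" unfolding g(2)[OF x(1)] .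
    qed
    ultimately have "negligible (K \<inter> {z. poly V z \<noteq> 0} \<inter> ball z r)" by (rule negligible_subset)
    then show "\<exists>U. openin (top_of_set (K \<inter> {z. poly V z \<noteq> 0})) U \<and> z \<in> U \<and> negligible U"
      using z r(1) by (intro exI[of _ "K \<inter> {z. poly V z \<noteq> 0} \<inter> ball z r"]) auto
  qed
  moreover have "negligible {z. poly V z = 0}"
    using poly_roots_finite[OF V] by (rule negligible_finite)
  ultimately have "negligible (K \<inter> {z. poly V z \<noteq> 0} \<union> {z. poly V z = 0})" by (rule negligible_Un)
  then have "negligible K" by (rule negligible_subset) auto
  moreover have "K = {z. poly q z \<noteq> 0 \<and> norm (deriv (rational_fun p q) z) = 1}"
    by (auto simp: K_def f_def deriv_rational_fun)
  ultimately show ?thesis by simp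
qed

text \<open>A singular zero \<open>z\<close> of the perturbed function has
  \<open>c = cnj z - r z\<close> on the critical curve. These bad constants form the image of a null
  set under a differentiable map of the plane, so they fill no disc.\<close>

lemma perturb_regular:
  assumes "\<epsilon> > 0"
  obtains c where "norm c < \<epsilon>" "singular_zeros (p + [:c:] * q) q = {}"
proof -
  let ?r = "rational_fun p q"
  define K where "K = {z. poly q z \<noteq> 0 \<and> norm (deriv ?r z) = 1}"
  have "negligible ((\<lambda>z. cnj z - ?r z) ` K)"
  proof (rule negligible_differentiable_image_negligible)
    show "negligible K" unfolding K_def by (rule negligible_critical_curve)
    have "(\<lambda>z. cnj z - ?r z) differentiable at z" if "z \<in> K" for z
    proof (rule differentiable_diff)
      show "cnj differentiable at z"
        by (rule bounded_linear_imp_differentiable[OF bounded_linear_cnj])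
      show "?r differentiable at z"
        using rational_fun_has_deriv[of q z p] that
        by (auto simp: K_def field_differentiable_def intro!: field_differentiable_imp_differentiable)
    qed
    then show "(\<lambda>z. cnj z - ?r z) differentiable_on K"
      by (auto simp: differentiable_on_def intro: differentiable_at_withinI)
  qed simp
  moreover have "\<not> negligible (ball (0::complex) \<epsilon>)"
    using open_not_negligible[of "ball (0::complex) \<epsilon>"] assms by auto
  ultimately obtain c where c: "c \<in> ball 0 \<epsilon>" "c \<notin> (\<lambda>z. cnj z - ?r z) ` K"
    using negligible_subset by blast
  have "singular_zeros (p + [:c:] * q) q = {}"
  proof (rule ccontr)
    assume "singular_zeros (p + [:c:] * q) q \<noteq> {}"
    then obtain z where z: "poly q z \<noteq> 0" "?r z + c = cnj z" "norm (deriv ?r z) = 1"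
      by (auto simp: singular_zeros_def harmonic_zeros_def rational_harmonic_def rational_fun_perturb
          simp del: mult_pCons_left)
    then have "c = cnj z - ?r z" "z \<in> K" by (auto simp: K_def algebra_simps)
    then show False using c(2) by blast
  qed
  then show ?thesis using that c(1) by simp
qed

end

subsection \<open>Counting sense-preserving zeros\<close>

lemma poly_over_power_tendsto:
  fixes p :: "complex poly"
  assumes "degree p \<le> m"
  shows "((\<lambda>z. poly p z / z ^ m) \<longlongrightarrow> coeff p m) at_infinity"
proof -
  have "((\<lambda>z. \<Sum>i\<le>m. coeff p i * inverse z ^ (m - i)) \<longlongrightarrow> (\<Sum>i\<le>m. coeff p i * 0 ^ (m - i))) at_infinity"
    by (intro tendsto_intros tendsto_inverse_0)
  moreover have "(\<Sum>i\<le>m. coeff p i * 0 ^ (m - i)) = (\<Sum>i\<le>m. if i = m then coeff p i else 0)"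
    by (intro sum.cong) (auto simp: power_0_left)
  moreover have "\<forall>\<^sub>F z in at_infinity. (\<Sum>i\<le>m. coeff p i * inverse z ^ (m - i)) = poly p z / z ^ m"
  proof (rule eventually_mono[OF eventually_not_equal_at_infinity[of 0]])
    fix z :: complex assume z: "z \<noteq> 0"
    have "poly p z = (\<Sum>i\<le>m. coeff p i * z ^ i)"
      unfolding poly_altdef using assms by (intro sum.mono_neutral_left) (auto simp: coeff_eq_0)
    then have "poly p z / z ^ m = (\<Sum>i\<le>m. coeff p i * z ^ i / z ^ m)" by (simp add: sum_divide_distrib)
    also have "\<dots> = (\<Sum>i\<le>m. coeff p i * inverse z ^ (m - i))"
      using z by (intro sum.cong) (auto simp: power_diff field_simps)
    finally show "(\<Sum>i\<le>m. coeff p i * inverse z ^ (m - i)) = poly p z / z ^ m" by simp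
  qed
  ultimately show ?thesis using Lim_transform_eventually by simp
qed

text \<open>The subordinate term carries a unimodular factor such as
  \<open>cnj (z - x) / (z - x)\<close> that has no limit; therefore \<open>w\<close> ranges over
  everything of the same modulus as \<open>B z\<close>.\<close>

lemma eventually_Re_pos:
  assumes A: "(A \<longlongrightarrow> 1) F" and B: "(B \<longlongrightarrow> L) F" and L: "norm L < 1"
  shows "\<forall>\<^sub>F z in F. \<forall>w. norm w = norm (B z) \<longrightarrow> Re (A z - w) > 0"
proof -
  have "((\<lambda>z. Re (A z) - norm (B z)) \<longlongrightarrow> Re 1 - norm L) F" by (intro tendsto_intros A B)
  then have "\<forall>\<^sub>F z in F. Re (A z) - norm (B z) > 0" by (rule order_tendstoD) (use L in simp)
  then show ?thesis
  proof (rule eventually_mono, intro allI impI)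
    fix z and w :: complex assume "Re (A z) - norm (B z) > 0" "norm w = norm (B z)"
    then show "Re (A z - w) > 0" using complex_Re_le_cmod[of w] by simp
  qed
qed

text \<open>Clearing the denominator gives a function continuous on the whole plane. It gains no
  zeros at the poles when \<open>p\<close> and \<open>q\<close> have no common root.\<close>

definition harmonic_numerator :: "complex poly \<Rightarrow> complex poly \<Rightarrow> complex \<Rightarrow> complex" where
  "harmonic_numerator p q z = poly p z - cnj z * poly q z"

lemma harmonic_numerator_eq:
  assumes "poly q z \<noteq> 0"
  shows "harmonic_numerator p q z = poly q z * (rational_fun p q z - cnj z)"
  using assms by (simp add: harmonic_numerator_def rational_fun_def field_simps)

lemma difference_quotient_tendsto:
  assumes "poly q x \<noteq> 0"
  shows "((\<lambda>z. (rational_fun p q z - rational_fun p q x) / (z - x)) \<longlongrightarrow> deriv (rational_fun p q) x) (at x)"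
  using rational_fun_has_deriv[OF assms, of p] deriv_rational_fun[OF assms, of p]
  by (simp add: has_field_derivative_iff)

lemma poly_tendsto_at: "(poly q \<longlongrightarrow> poly q x) (at (x::complex))"
  using DERIV_isCont[OF poly_DERIV] by (simp add: isCont_def)

lemma poly_ratio_tendsto: "poly q x \<noteq> 0 \<Longrightarrow> ((\<lambda>z. poly q z / poly q x) \<longlongrightarrow> 1) (at (x::complex))"
  using tendsto_divide[OF poly_tendsto_at[of q x] tendsto_const[of "poly q x"]] by simp

lemma eventually_nonpole: "poly q x \<noteq> 0 \<Longrightarrow> \<forall>\<^sub>F z in at (x::complex). poly q z \<noteq> 0"
  using poly_tendsto_at by (rule tendsto_imp_eventually_ne)

lemma eventually_at_ball:
  assumes "\<forall>\<^sub>F z in at x. P z"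
  shows "\<exists>\<epsilon>>0. \<forall>z\<in>ball x \<epsilon> - {x}. P z"
proof -
  obtain d where "d > 0" "\<forall>z. z \<noteq> x \<and> dist z x < d \<longrightarrow> P z" using assms unfolding eventually_at by auto
  then show ?thesis by (intro exI[of _ d]) (auto simp: dist_commute)
qed

text \<open>Near \<open>x\<close> the holomorphic part \<open>D * (z - x)\<close> dominates
  \<open>cnj (z - x)\<close>, so \<open>\<alpha>\<close> is \<open>poly q x * D\<close>.\<close>

lemma numerator_at_sense_preserving:
  assumes x: "x \<in> sense_preserving_zeros p q"
  shows "\<exists>\<epsilon>>0. \<exists>\<alpha>. \<alpha> \<noteq> 0 \<and> (\<forall>z\<in>ball x \<epsilon> - {x}. Re (harmonic_numerator p q z / (\<alpha> * (z - x))) > 0)"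
proof -
  let ?r = "rational_fun p q"
  define D where "D = deriv ?r x"
  have qx: "poly q x \<noteq> 0" and rx: "?r x = cnj x" and D: "norm D > 1"
    using x by (auto simp: sense_preserving_zeros_def harmonic_zeros_def rational_harmonic_def D_def)
  have D0: "D \<noteq> 0" using D by auto
  define A where "A z = (poly q z / poly q x) * (((?r z - ?r x) / (z - x)) / D)" for z
  define B where "B z = (poly q z / poly q x) * (1 / D)" for z
  have "(A \<longlongrightarrow> 1 * (D / D)) (at x)"
    unfolding A_def D_def using D0 by (intro tendsto_intros poly_ratio_tendsto difference_quotient_tendsto qx) (simp add: D_def)
  then have A: "(A \<longlongrightarrow> 1) (at x)" using D0 by simp
  have B: "(B \<longlongrightarrow> 1 * (1 / D)) (at x)"
    unfolding B_def by (intro tendsto_mult tendsto_const poly_ratio_tendsto qx)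
  have "\<forall>\<^sub>F z in at x. \<forall>w. norm w = norm (B z) \<longrightarrow> Re (A z - w) > 0"
    by (rule eventually_Re_pos[OF A B]) (use D D0 in \<open>simp add: norm_divide divide_less_eq\<close>)
  moreover have "\<forall>\<^sub>F z in at x. poly q z \<noteq> 0" by (rule eventually_nonpole[OF qx])
  moreover have "\<forall>\<^sub>F z in at x. z \<noteq> x" by (simp add: eventually_at_filter)
  ultimately have "\<forall>\<^sub>F z in at x. Re (harmonic_numerator p q z / (poly q x * D * (z - x))) > 0"
  proof eventually_elim
    case (elim z)
    have "harmonic_numerator p q z = poly q z * ((?r z - ?r x) - cnj (z - x))"
      using harmonic_numerator_eq[of q z p] elim rx by simp
    then have "harmonic_numerator p q z / (poly q x * D * (z - x)) = A z - B z * (cnj (z - x) / (z - x))"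
      using elim qx D0 unfolding A_def B_def by (simp add: divide_simps del: complex_cnj_diff) (simp add: algebra_simps)
    moreover have "norm (B z * (cnj (z - x) / (z - x))) = norm (B z)"
      using elim by (simp add: norm_mult norm_divide del: complex_cnj_diff)
    ultimately show ?case using elim by simp
  qed
  from eventually_at_ball[OF this] show ?thesis using qx D0 by (metis mult_eq_0_iff)
qed

text \<open>Here \<open>- cnj (z - x)\<close> dominates the holomorphic part, so
  \<open>\<beta>\<close> is \<open>- poly q x\<close>.\<close>

lemma numerator_at_sense_reversing:
  assumes x: "x \<in> sense_reversing_zeros p q"
  shows "\<exists>\<epsilon>>0. \<exists>\<beta>. \<beta> \<noteq> 0 \<and> (\<forall>z\<in>ball x \<epsilon> - {x}. Re (harmonic_numerator p q z / (\<beta> * cnj (z - x))) > 0)"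
proof -
  let ?r = "rational_fun p q"
  define D where "D = deriv ?r x"
  have qx: "poly q x \<noteq> 0" and rx: "?r x = cnj x" and D: "norm D < 1"
    using x by (auto simp: sense_reversing_zeros_def harmonic_zeros_def rational_harmonic_def D_def)
  define A where "A z = poly q z / poly q x" for z
  define B where "B z = (poly q z / poly q x) * ((?r z - ?r x) / (z - x))" for z
  have A: "(A \<longlongrightarrow> 1) (at x)" unfolding A_def by (rule poly_ratio_tendsto[OF qx])
  have B: "(B \<longlongrightarrow> 1 * D) (at x)"
    unfolding B_def D_def by (intro tendsto_mult poly_ratio_tendsto difference_quotient_tendsto qx)
  have "\<forall>\<^sub>F z in at x. \<forall>w. norm w = norm (B z) \<longrightarrow> Re (A z - w) > 0"
    by (rule eventually_Re_pos[OF A B]) (use D in simp)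
  moreover have "\<forall>\<^sub>F z in at x. poly q z \<noteq> 0" by (rule eventually_nonpole[OF qx])
  moreover have "\<forall>\<^sub>F z in at x. z \<noteq> x" by (simp add: eventually_at_filter)
  ultimately have "\<forall>\<^sub>F z in at x. Re (harmonic_numerator p q z / (- poly q x * cnj (z - x))) > 0"
  proof eventually_elim
    case (elim z)
    have c0: "cnj (z - x) \<noteq> 0" using elim by (metis complex_cnj_zero_iff right_minus_eq)
    have "harmonic_numerator p q z = poly q z * ((?r z - ?r x) - cnj (z - x))"
      using harmonic_numerator_eq[of q z p] elim rx by simp
    then have "harmonic_numerator p q z / (- poly q x * cnj (z - x)) = A z - B z * ((z - x) / cnj (z - x))"
      using elim qx c0 unfolding A_def B_def by (simp add: divide_simps del: complex_cnj_diff) (simp add: algebra_simps)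
    moreover have "norm (B z * ((z - x) / cnj (z - x))) = norm (B z)"
      using elim by (simp add: norm_mult norm_divide del: complex_cnj_diff)
    ultimately show ?case using elim by simp
  qed
  from eventually_at_ball[OF this] show ?thesis using qx by (metis neg_equal_0_iff_equal)
qed

text \<open>Infinity is repelling, or not fixed when the coefficient of \<open>p\<close> is 0. The
  term \<open>- cnj z * poly q z\<close> dominates, with winding
  \<open>degree q - 1\<close>.\<close>

lemma numerator_at_infinity_denominator:
  assumes dp: "degree p \<le> Suc (degree q)" and lt: "norm (coeff p (Suc (degree q))) < norm (lead_coeff q)"
  shows "\<exists>R. \<forall>z. norm z > R \<longrightarrow> Re (harmonic_numerator p q z / (- lead_coeff q * (z ^ degree q * cnj z ^ 1))) > 0"
proof -
  let ?m = "degree q"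
  have l0: "lead_coeff q \<noteq> 0" using lt by auto
  define A where "A z = (poly q z / z ^ ?m) / lead_coeff q" for z
  define B where "B z = (poly p z / z ^ Suc ?m) / lead_coeff q" for z
  have "(A \<longlongrightarrow> lead_coeff q / lead_coeff q) at_infinity"
    unfolding A_def using l0 by (intro tendsto_divide poly_over_power_tendsto tendsto_const) auto
  then have A: "(A \<longlongrightarrow> 1) at_infinity" using l0 by simp
  have B: "(B \<longlongrightarrow> coeff p (Suc ?m) / lead_coeff q) at_infinity"
    unfolding B_def using l0 dp by (intro tendsto_divide poly_over_power_tendsto tendsto_const) auto
  have "\<forall>\<^sub>F z in at_infinity. \<forall>w. norm w = norm (B z) \<longrightarrow> Re (A z - w) > 0"
    by (rule eventually_Re_pos[OF A B]) (use lt l0 in \<open>simp add: norm_divide\<close>)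
  moreover have "\<forall>\<^sub>F z in at_infinity. z \<noteq> (0::complex)" by (rule eventually_not_equal_at_infinity)
  ultimately have "\<forall>\<^sub>F z in at_infinity. Re (harmonic_numerator p q z / (- lead_coeff q * (z ^ ?m * cnj z ^ 1))) > 0"
  proof eventually_elim
    case (elim z)
    have "harmonic_numerator p q z / (- lead_coeff q * (z ^ ?m * cnj z ^ 1)) = A z - B z * (z / cnj z)"
      using elim l0 unfolding A_def B_def harmonic_numerator_def by (simp add: divide_simps)
    moreover have "norm (B z * (z / cnj z)) = norm (B z)" using elim by (simp add: norm_mult norm_divide)
    ultimately show ?case using elim by simp
  qed
  then obtain b where "\<forall>z. norm z \<ge> b \<longrightarrow> Re (harmonic_numerator p q z / (- lead_coeff q * (z ^ ?m * cnj z ^ 1))) > 0"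
    unfolding eventually_at_infinity by blast
  then show ?thesis by (intro exI[of _ b]) auto
qed

text \<open>Infinity is attracting and \<open>poly p z\<close> dominates, with winding
  \<open>degree p\<close>.\<close>

lemma numerator_at_infinity_numerator:
  assumes dq: "degree q < degree p" and lt: "norm (coeff q (degree p - 1)) < norm (lead_coeff p)"
  shows "\<exists>R. \<forall>z. norm z > R \<longrightarrow> Re (harmonic_numerator p q z / (lead_coeff p * (z ^ degree p * cnj z ^ 0))) > 0"
proof -
  obtain m where m: "degree p = Suc m" using dq by (cases "degree p") auto
  have l0: "lead_coeff p \<noteq> 0" using lt by auto
  define A where "A z = (poly p z / z ^ Suc m) / lead_coeff p" for z
  define B where "B z = (poly q z / z ^ m) / lead_coeff p" for z
  have "(A \<longlongrightarrow> coeff p (Suc m) / lead_coeff p) at_infinity"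
    unfolding A_def using l0 m by (intro tendsto_divide poly_over_power_tendsto tendsto_const) auto
  then have A: "(A \<longlongrightarrow> 1) at_infinity" using l0 m by simp
  have B: "(B \<longlongrightarrow> coeff q m / lead_coeff p) at_infinity"
    unfolding B_def using l0 dq m by (intro tendsto_divide poly_over_power_tendsto tendsto_const) auto
  have "\<forall>\<^sub>F z in at_infinity. \<forall>w. norm w = norm (B z) \<longrightarrow> Re (A z - w) > 0"
    by (rule eventually_Re_pos[OF A B]) (use lt l0 m in \<open>simp add: norm_divide\<close>)
  moreover have "\<forall>\<^sub>F z in at_infinity. z \<noteq> (0::complex)" by (rule eventually_not_equal_at_infinity)
  ultimately have "\<forall>\<^sub>F z in at_infinity. Re (harmonic_numerator p q z / (lead_coeff p * (z ^ degree p * cnj z ^ 0))) > 0"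
  proof eventually_elim
    case (elim z)
    have "harmonic_numerator p q z / (lead_coeff p * (z ^ degree p * cnj z ^ 0)) = A z - B z * (cnj z / z)"
      using elim l0 unfolding A_def B_def harmonic_numerator_def m by (simp add: divide_simps)
    moreover have "norm (B z * (cnj z / z)) = norm (B z)" using elim by (simp add: norm_mult norm_divide)
    ultimately show ?case using elim by simp
  qed
  then obtain b where "\<forall>z. norm z \<ge> b \<longrightarrow> Re (harmonic_numerator p q z / (lead_coeff p * (z ^ degree p * cnj z ^ 0))) > 0"
    unfolding eventually_at_infinity by blast
  then show ?thesis by (intro exI[of _ b]) auto
qed

section \<open>Zero counts from the winding at infinity\<close>

context rational_pair
begin

lemma finite_nonrepelling: "finite (nonrepelling p q)" "card (nonrepelling p q) \<le> 2 * n - 2"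
  using finite_if_finite_subsets_card_bdd[of "nonrepelling p q" "2 * n - 2"] card_nonrepelling by blast+

lemma harmonic_numerator_zero_iff: "harmonic_numerator p q z = 0 \<longleftrightarrow> z \<in> harmonic_zeros p q"
proof (cases "poly q z = 0")
  case True
  then show ?thesis using no_common_root'[of z] by (simp add: harmonic_numerator_def harmonic_zeros_def)
next
  case False
  then show ?thesis by (simp add: harmonic_numerator_eq harmonic_zeros_def rational_harmonic_def)
qed

lemma regular_count:
  assumes reg: "singular_zeros p q = {}"
    and inf: "\<gamma> \<noteq> 0" "\<And>z. norm z > R \<Longrightarrow> Re (harmonic_numerator p q z / (\<gamma> * (z ^ k * cnj z ^ l))) > 0"
  shows "finite (sense_preserving_zeros p q)"
    and "k + card (nonrepelling p q) = l + card (sense_preserving_zeros p q)"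
proof -
  let ?\<phi> = "harmonic_numerator p q" and ?P = "sense_preserving_zeros p q" and ?N = "nonrepelling p q"
  have N: "?N = sense_reversing_zeros p q" using reg by (simp add: nonrepelling_eq)
  have cont: "continuous_on UNIV ?\<phi>" unfolding harmonic_numerator_def by (intro continuous_intros)
  have zero: "?\<phi> z = 0 \<longleftrightarrow> z \<in> ?P \<union> ?N" for z
    by (simp add: harmonic_numerator_zero_iff harmonic_zeros_eq(1))
  note plus = numerator_at_sense_preserving
  have minus: "\<exists>\<epsilon>>0. \<exists>\<beta>. \<beta> \<noteq> 0 \<and> (\<forall>z\<in>ball x \<epsilon> - {x}. Re (?\<phi> z / (\<beta> * cnj (z - x))) > 0)" if "x \<in> ?N" for x
    using that numerator_at_sense_reversing unfolding N by blast
  \<comment> \<open>The behaviour at infinity makes the zero set compact, and the local models make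
    each zero isolated.\<close>
  have "finite ({z. ?\<phi> z = 0} \<inter> ?P)"
  proof (rule finite_not_islimpt_in_compact)
    have "norm z \<le> R" if "?\<phi> z = 0" for z using inf(2)[of z] that by (cases "norm z > R") auto
    then have "bounded {z. ?\<phi> z = 0}" unfolding bounded_iff by blast
    moreover have "closed {z. ?\<phi> z = 0}"
      using continuous_closed_preimage_constant[OF cont closed_UNIV, of 0] by simp
    ultimately show "compact {z. ?\<phi> z = 0}" by (simp add: compact_eq_bounded_closed)
    fix x assume "x \<in> {z. ?\<phi> z = 0}"
    then have "x \<in> ?P \<or> x \<in> ?N" using zero by simp
    then have "\<exists>\<epsilon>>0. \<forall>z\<in>ball x \<epsilon> - {x}. ?\<phi> z \<noteq> 0"
    proof
      assume "x \<in> ?P"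
      from plus[OF this] obtain \<epsilon> \<alpha> where "\<epsilon> > 0" "\<forall>z\<in>ball x \<epsilon> - {x}. Re (?\<phi> z / (\<alpha> * (z - x))) > 0" by blast
      then show ?thesis by (intro exI[of _ \<epsilon>]) force
    next
      assume "x \<in> ?N"
      from minus[OF this] obtain \<epsilon> \<alpha> where "\<epsilon> > 0" "\<forall>z\<in>ball x \<epsilon> - {x}. Re (?\<phi> z / (\<alpha> * cnj (z - x))) > 0" by blast
      then show ?thesis by (intro exI[of _ \<epsilon>]) force
    qed
    then obtain \<epsilon> where "\<epsilon> > 0" "\<And>z. z \<in> ball x \<epsilon> - {x} \<Longrightarrow> ?\<phi> z \<noteq> 0" by blast
    then show "\<not> x islimpt ?P"
      unfolding islimpt_approachable using zero by (metis DiffI UnI1 dist_commute mem_ball singletonD)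
  qed
  moreover have "{z. ?\<phi> z = 0} \<inter> ?P = ?P" using zero by blast
  ultimately show fin: "finite ?P" by simp
  show "k + card ?N = l + card ?P"
    by (rule zero_count[OF cont fin finite_nonrepelling(1) harmonic_zeros_eq(2) _ plus minus inf])
      (use zero in auto)
qed

lemma regular_card_denominator:
  assumes "singular_zeros p q = {}" "degree p \<le> Suc (degree q)" "norm (coeff p (Suc (degree q))) < norm (lead_coeff q)"
  shows "finite (sense_preserving_zeros p q)" "card (sense_preserving_zeros p q) \<le> degree q + 2 * n - 3"
proof -
  obtain R where R: "\<And>z. norm z > R \<Longrightarrow>
      Re (harmonic_numerator p q z / (- lead_coeff q * (z ^ degree q * cnj z ^ 1))) > 0"
    using numerator_at_infinity_denominator[OF assms(2,3)] by blast
  have "- lead_coeff q \<noteq> 0" using q_nonzero' by simp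
  note c = regular_count[where R = R, OF assms(1) this R]
  show "finite (sense_preserving_zeros p q)" by (rule c(1))
  show "card (sense_preserving_zeros p q) \<le> degree q + 2 * n - 3" using c(2) finite_nonrepelling(2) n_ge_2' by arith
qed

lemma rational_pair_perturb:
  assumes "degree (p + s * q) \<le> n" "degree q = n \<or> coeff (p + s * q) n \<noteq> 0"
  shows "rational_pair (p + s * q) q n"
proof
  show "max (degree (p + s * q)) (degree q) = n"
    using assms le_degree[of "p + s * q" n] max_deg by auto
  show "n \<ge> 2" by (rule n_ge_2')
  show "poly (p + s * q) z \<noteq> 0 \<or> poly q z \<noteq> 0" for z
    using no_common_root'[of z] by auto
qed

text \<open>Finite subsets are used because finiteness of the full set is not yet known; persistence
  moves \<open>X\<close> to a regular \<open>r + c\<close> with the same behaviour at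
  infinity.\<close>

lemma card_sense_preserving_subset_denominator:
  assumes X: "finite X" "X \<subseteq> sense_preserving_zeros p q"
    and d: "degree p \<le> Suc (degree q)" and lt: "norm (coeff p (Suc (degree q))) < norm (lead_coeff q)"
  shows "card X \<le> degree q + 2 * n - 3"
proof -
  obtain \<epsilon> where \<epsilon>: "\<epsilon> > 0" and per: "\<And>c e. norm c < \<epsilon> \<Longrightarrow> norm e < \<epsilon> \<Longrightarrow>
    \<exists>Y. finite Y \<and> Y \<subseteq> sense_preserving_zeros (p + [:c, e:] * q) q \<and> card Y = card X"
    using sense_preserving_persist[OF X] by blast
  obtain c where c: "norm c < \<epsilon>" "singular_zeros (p + [:c:] * q) q = {}" using perturb_regular[OF \<epsilon>] by blast
  let ?p = "p + [:c:] * q"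
  have dc: "degree ([:c:] * q) \<le> degree q" by (simp add: degree_smult_le)
  \<comment> \<open>A constant added to \<open>r\<close> alters \<open>p\<close> only up to degree
    \<open>degree q\<close>, so the coefficient compared in \<open>lt\<close> survives.\<close>
  have co: "coeff ?p (Suc (degree q)) = coeff p (Suc (degree q))" by (simp add: coeff_eq_0)
  have dp: "degree ?p \<le> n" using dc deg_le by (intro degree_add_le) auto
  have "degree q = n \<or> coeff ?p n \<noteq> 0"
  proof (cases "degree q = n")
    case False
    then have "degree p = n" "degree q < n" using max_deg by auto
    then show ?thesis using n_ge_2' by (auto simp: coeff_eq_0)
  qed simp
  then interpret P: rational_pair ?p q n using rational_pair_perturb[of "[:c:]"] dp by blast
  obtain Y where Y: "finite Y" "Y \<subseteq> sense_preserving_zeros (p + [:c, 0:] * q) q" "card Y = card X"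
    using per[OF c(1), of 0] \<epsilon> by auto
  have "[:c, 0:] = [:c:]" by simp
  then have YS: "Y \<subseteq> sense_preserving_zeros ?p q" using Y(2) by metis
  have "degree ?p \<le> Suc (degree q)" using d dc by (intro degree_add_le) auto
  note R = P.regular_card_denominator[OF c(2) this] 
  have "norm (coeff ?p (Suc (degree q))) < norm (lead_coeff q)" unfolding co by (rule lt)
  then show ?thesis using card_mono[OF R(1) YS] R(2) Y(3) by simp
qed

lemma card_sense_preserving_denominator:
  assumes "degree p \<le> Suc (degree q)" "norm (coeff p (Suc (degree q))) < norm (lead_coeff q)"
  shows "finite (sense_preserving_zeros p q) \<and> card (sense_preserving_zeros p q) \<le> degree q + 2 * n - 3"
  using finite_if_finite_subsets_card_bdd card_sense_preserving_subset_denominator[OF _ _ assms] by metis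

end

context fixed_infinity
begin

text \<open>Attracting infinity gives winding \<open>n\<close>, compensated by the sharper bound
  \<open>2 * n - 3\<close> for the non-repelling points.\<close>

lemma card_sense_preserving_numerator:
  assumes lt: "norm (coeff q (n - 1)) < norm (lead_coeff p)"
  shows "finite (sense_preserving_zeros p q) \<and> card (sense_preserving_zeros p q) \<le> 3 * n - 3"
proof (rule finite_if_finite_subsets_card_bdd)
  fix X assume X: "X \<subseteq> sense_preserving_zeros p q" "finite X"
  interpret R: rational_pair p q n by (rule rational_pair)
  obtain \<epsilon> where \<epsilon>: "\<epsilon> > 0" and per: "\<And>c e. norm c < \<epsilon> \<Longrightarrow> norm e < \<epsilon> \<Longrightarrow>
    \<exists>Y. finite Y \<and> Y \<subseteq> sense_preserving_zeros (p + [:c, e:] * q) q \<and> card Y = card X"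
    using sense_preserving_persist[OF X(2,1)] by blast
  obtain c where c: "norm c < \<epsilon>" "singular_zeros (p + [:c:] * q) q = {}" using R.perturb_regular[OF \<epsilon>] by blast
  let ?p = "p + [:c:] * q"
  have dc: "degree ([:c:] * q) < n" using degree_smult_le[of c q] deg_q by simp
  have dp: "degree ?p = n" using dc deg_p by (subst degree_add_eq_left) auto
  have lp: "lead_coeff ?p = lead_coeff p" using dp deg_p deg_q by (simp add: coeff_eq_0)
  interpret P: fixed_infinity ?p q n
  proof
    show "poly ?p z \<noteq> 0 \<or> poly q z \<noteq> 0" for z using no_common_root[of z] by auto
  qed (use dp deg_q n_ge_2 in auto)
  interpret PR: rational_pair ?p q n by (rule P.rational_pair)
  obtain Y where Y: "finite Y" "Y \<subseteq> sense_preserving_zeros (p + [:c, 0:] * q) q" "card Y = card X"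
    using per[OF c(1), of 0] \<epsilon> by auto
  have "[:c, 0:] = [:c:]" by simp
  then have YS: "Y \<subseteq> sense_preserving_zeros ?p q" using Y(2) by metis
  have lt': "norm (coeff q (degree ?p - 1)) < norm (lead_coeff ?p)" by (simp only: lp) (simp only: dp lt)
  obtain S where S: "\<And>z. norm z > S \<Longrightarrow>
      Re (harmonic_numerator ?p q z / (lead_coeff ?p * (z ^ degree ?p * cnj z ^ 0))) > 0"
    using numerator_at_infinity_numerator[OF _ lt'] dp deg_q by auto
  have "lead_coeff ?p \<noteq> 0" using lt' by auto
  note C = PR.regular_count[where R = S, OF c(2) this S]
  have "card (nonrepelling ?p q) \<le> 2 * n - 3"
    by (rule P.card_nonrepelling_fixed_infinity) (use lt' dp PR.finite_nonrepelling in auto)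
  then show "card X \<le> 3 * n - 3" using card_mono[OF C(1) YS] C(2) Y(3) dp n_ge_2 by arith
qed

text \<open>Here infinity is a neutral fixed point; a perturbation of the leading coefficient makes it repelling.\<close>

lemma card_sense_preserving_neutral:
  assumes eq: "norm (coeff q (n - 1)) = norm (lead_coeff p)"
  shows "finite (sense_preserving_zeros p q) \<and> card (sense_preserving_zeros p q) \<le> 3 * n - 4"
proof (rule finite_if_finite_subsets_card_bdd)
  fix X assume X: "X \<subseteq> sense_preserving_zeros p q" "finite X"
  interpret R: rational_pair p q n by (rule rational_pair)
  have lp0: "lead_coeff p \<noteq> 0" using deg_p n_ge_2 by auto
  then have cq: "coeff q (n - 1) \<noteq> 0" using eq by auto
  then have dq: "degree q = n - 1" using le_degree[OF cq] deg_q by linarith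
  obtain \<epsilon> where \<epsilon>: "\<epsilon> > 0" and per: "\<And>c e. norm c < \<epsilon> \<Longrightarrow> norm e < \<epsilon> \<Longrightarrow>
    \<exists>Y. finite Y \<and> Y \<subseteq> sense_preserving_zeros (p + [:c, e:] * q) q \<and> card Y = card X"
    using sense_preserving_persist[OF X(2,1)] by blast
  define t where "t = min (1/2) (\<epsilon> / 2)"
  have t: "0 < t" "t < 1" "t < \<epsilon>" using \<epsilon> by (auto simp: t_def)
  \<comment> \<open>This multiplies the leading coefficient of \<open>p\<close> by
    \<open>1 - t\<close>, so the multiplier of infinity gets modulus above 1 while the degree stays
    \<open>n\<close>.\<close>
  define e where "e = - of_real t * lead_coeff p / coeff q (n - 1)"
  have ne: "norm e = t" using eq t(1) lp0 by (simp add: e_def norm_mult norm_divide)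
  let ?p = "p + [:0, e:] * q"
  have dp: "degree ?p \<le> n"
    by (intro degree_add_le order_trans[OF degree_mult_le]) (use deg_p dq n_ge_2 in auto)
  have cp: "coeff ?p n = of_real (1 - t) * lead_coeff p"
  proof -
    have "coeff ([:0, e:] * q) n = e * coeff q (n - 1)" using n_ge_2 by (cases n) (auto simp: coeff_pCons)
    then show ?thesis using cq deg_p by (simp add: e_def algebra_simps)
  qed
  interpret P: rational_pair ?p q n
    by (rule R.rational_pair_perturb[OF dp]) (use cp t lp0 in auto)
  obtain Y where Y: "finite Y" "Y \<subseteq> sense_preserving_zeros ?p q" "card Y = card X"
    using per[of 0 e] \<epsilon> ne t by auto
  have "norm (coeff ?p n) = (1 - t) * norm (lead_coeff p)"
    unfolding cp norm_mult norm_of_real using t by simp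
  also have "\<dots> < norm (lead_coeff q)" using t lp0 eq dq by simp
  finally have "norm (coeff ?p (Suc (degree q))) < norm (lead_coeff q)" using dq n_ge_2 by simp
  then have "finite (sense_preserving_zeros ?p q) \<and> card (sense_preserving_zeros ?p q) \<le> degree q + 2 * n - 3"
    by (intro P.card_sense_preserving_denominator) (use dp dq n_ge_2 in auto)
  then have "card Y \<le> degree q + 2 * n - 3" using card_mono[OF _ Y(2)] by linarith
  then show "card X \<le> 3 * n - 4" using Y(3) dq n_ge_2 by linarith
qed

end

theorem theorem1p1:
  fixes p q :: "complex poly" and n :: nat
  assumes "q \<noteq> 0" and "coprime p q"
    and "rational_degree p q = n" and "n \<ge> 2"
  shows "(finite (sense_preserving_zeros p q) \<and>
            card (sense_preserving_zeros p q) \<le> 3 * (n - 1)) \<and>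
         (finite (sense_reversing_zeros p q \<union> singular_zeros p q) \<and>
            card (sense_reversing_zeros p q \<union> singular_zeros p q) \<le> 2 * (n - 1)) \<and>
         (degree p > degree q \<longrightarrow>
            finite (harmonic_zeros p q) \<and> card (harmonic_zeros p q) \<le> 5 * (n - 1) - 1)"
proof -
  let ?P = "sense_preserving_zeros p q" and ?N = "nonrepelling p q"
  interpret rational_pair p q n
    using assms coprime_poly_0[OF assms(2)] by unfold_locales (auto simp: rational_degree_def)
  have "finite ?P \<and> card ?P \<le> 3 * (n - 1) \<and> (degree p > degree q \<longrightarrow> card ?P + card ?N \<le> 5 * (n - 1) - 1)"
  proof (cases "degree p > degree q")
    case False
    \<comment> \<open>Infinity is not fixed here: the winding \<open>n - 1\<close> plus
      \<open>2 * n - 2\<close> non-repelling points gives \<open>3 * n - 3\<close>.\<close>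
    then have "degree q = n" "coeff p (Suc (degree q)) = 0" using max_deg by (auto simp: coeff_eq_0)
    then show ?thesis using card_sense_preserving_denominator False q_nonzero' by auto
  next
    case True
    then interpret F: fixed_infinity p q n
      using max_deg n_ge_2' no_common_root' by unfold_locales auto
    \<comment> \<open>Infinity is attracting, neutral or repelling. The sums of the two bounds are
      \<open>(3n - 3) + (2n - 3)\<close>, \<open>(3n - 4) + (2n - 3)\<close> and
      \<open>(3n - 4) + (2n - 2)\<close>, none above \<open>5n - 6\<close>.\<close>
    consider "norm (coeff q (n - 1)) < norm (lead_coeff p)" | "norm (coeff q (n - 1)) = norm (lead_coeff p)"
      | "norm (coeff q (n - 1)) > norm (lead_coeff p)" by linarith
    then show ?thesis
    proof cases
      case 1
      then show ?thesis
        using F.card_sense_preserving_numerator F.card_nonrepelling_fixed_infinity[of ?N] finite_nonrepelling n_ge_2' by auto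
    next
      case 2
      then show ?thesis
        using F.card_sense_preserving_neutral F.card_nonrepelling_fixed_infinity[of ?N] finite_nonrepelling n_ge_2' by auto
    next
      case 3
      then have "coeff q (n - 1) \<noteq> 0" by auto
      then have dq: "degree q = n - 1" using le_degree[of q "n - 1"] F.deg_q by linarith
      then have sq: "Suc (degree q) = n" using n_ge_2' by simp
      then have "finite ?P \<and> card ?P \<le> degree q + 2 * n - 3"
        using 3 F.deg_p dq by (intro card_sense_preserving_denominator) auto
      then show ?thesis using dq finite_nonrepelling n_ge_2' by auto
    qed
  qed
  moreover have "card (?P \<union> ?N) \<le> card ?P + card ?N" by (rule card_Un_le)
  ultimately show ?thesis
    unfolding nonrepelling_eq[symmetric] harmonic_zeros_eq(1)
    using finite_nonrepelling by (auto intro: order_trans)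
qed

end
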